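(* Let $0\le m\le n$, let $F_n$ be the free group with basis $\{x_1,\ldots,x_n\}$, and let $Y=\{x_{m+1},\ldots,x_n\}$. The subgroups $\mathrm{Fix}(Y)$ and $\mathrm{Fix}_c(Y)$ of $\mathrm{Aut}(F_n)$ are generated by the Whitehead automorphisms that lie in $\mathrm{Fix}(Y)$ and $\mathrm{Fix}_c(Y)$ respectively. Moreover, $\mathrm{Fix}(Y)$ is generated by $$\mathcal{A}_m=\{S_i,\rho_{ij}: 1\le i\le m,\ 1\le j\le n,\ i\ne j\},$$ where $S_i$ is included for every $1\le i\le m$, and $\mathrm{Fix}_c(Y)$ is generated by $$\mathcal{B}_m=\mathcal{A}_m\cup\{K_{ij}: m+1\le i\le n,\ 1\le j\le n,\ i\neq j\}.$$
   Context: $\mathrm{Fix}(Y)$ is the subgroup of $\mathrm{Aut}(F_n)$ of automorphisms fixing each element of $Y$; $\mathrm{Fix}_c(Y)$ is the subgroup of automorphisms taking each element of $Y$ to a conjugate of itself in $F_n$. Whitehead automorphisms (with respect to $X=\{x_1,\ldots,x_n\}$) are of two types. The first type: automorphisms $\phi$ for which there are $\sigma\in S_n$ and $\epsilon_1,\ldots,\epsilon_n\in\{1,-1\}$ with $\phi(x_i)=x_{\sigma(i)}^{\epsilon_i}$ for all $i$. The second type: for $a\in X\cup X^{-1}$ and $A\subset X\cup X^{-1}$ with $a\in A$ and $a^{-1}\notin A$, the automorphism $(A,a)$ given by $(A,a)(x_j)=x_j$ if $x_j=a^{\pm1}$ and $(A,a)(x_j)=a^{\alpha_j}x_ja^{-\beta_j}$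 if $x_j\ne a^{\pm1}$, where $\alpha_j=\chi_A(x_j)$, $\beta_j=\chi_A(x_j^{-1})$ and $\chi_A$ is the indicator function of $A$. For $i\ne j$, the automorphisms $\rho_{ij}$ and $K_{ij}$ are defined by $\rho_{ij}(x_i)=x_ix_j$ and $\rho_{ij}(x_k)=x_k$ for $k\ne i$; $K_{ij}(x_i)=x_jx_ix_j^{-1}$ and $K_{ij}(x_k)=x_k$ for $k\neq i$. The automorphism $S_i$ is defined by $S_i(x_i)=x_i^{-1}$ and $S_i(x_k)=x_k$ for $k\ne i$. *)

theory Defs
  imports "HOL-Algebra.Bij" "HOL-Algebra.Generated_Groups" "HOL-Combinatorics.Permutations" "HOL-Library.Indicator_Function"
begin

section \<open>Free groups\<close>

text \<open>
  The free group on a set \<open>X\<close> is realised on the reduced words in the letters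
  \<open>(x, True)\<close>, standing for \<open>x\<close>, and \<open>(x, False)\<close>, standing for the inverse of \<open>x\<close>.
\<close>

definition inv_letter :: "'a \<times> bool \<Rightarrow> 'a \<times> bool" where
  "inv_letter l = (fst l, \<not> snd l)"

fun reduced :: "('a \<times> bool) list \<Rightarrow> bool" where
  "reduced [] = True"
| "reduced [l] = True"
| "reduced (k # l # w) = (k \<noteq> inv_letter l \<and> reduced (l # w))"

fun push_letter :: "'a \<times> bool \<Rightarrow> ('a \<times> bool) list \<Rightarrow> ('a \<times> bool) list" where
  "push_letter l [] = [l]"
| "push_letter l (k # w) = (if k = inv_letter l then w else l # k # w)"

definition free_group :: "'a set \<Rightarrow> ('a \<times> bool) list monoid" where
  "free_group X =
    \<lparr>carrier = {w. reduced w \<and> fst ` set w \<subseteq> X},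
     monoid.mult = \<lambda>u v. foldr push_letter u v,
     one = []\<rparr>"

definition free_gen :: "'a \<Rightarrow> ('a \<times> bool) list" where
  "free_gen x = [(x, True)]"

lemma inv_letter_simps [simp]:
  "inv_letter (inv_letter l) = l" "fst (inv_letter l) = fst l" "inv_letter l \<noteq> l"
  "l \<noteq> inv_letter l" "inv_letter k = inv_letter l \<longleftrightarrow> k = l"
  by (auto simp: inv_letter_def prod_eq_iff)

lemma reduced_ConsD: "reduced (l # w) \<Longrightarrow> reduced w"
  by (cases w) auto

lemma reduced_push: "reduced w \<Longrightarrow> reduced (push_letter l w)"
  by (cases w) (auto dest: reduced_ConsD)

lemma push_push_inv: "reduced w \<Longrightarrow> push_letter l (push_letter (inv_letter l) w) = w"
  by (cases w rule: reduced.cases) auto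

lemma push_inv_push: "reduced w \<Longrightarrow> push_letter (inv_letter l) (push_letter l w) = w"
  using push_push_inv[of w "inv_letter l"] by simp

lemma reduced_foldr_push: "reduced v \<Longrightarrow> reduced (foldr push_letter u v)"
  by (induction u) (auto simp: reduced_push)

lemma set_push: "set (push_letter l w) \<subseteq> insert l (set w)"
  by (cases w) auto

lemma set_foldr_push: "set (foldr push_letter u v) \<subseteq> set u \<union> set v"
proof (induction u)
  case (Cons l u)
  then show ?case using set_push[of l "foldr push_letter u v"] by auto
qed simp

lemma reduced_Cons_push: "reduced (l # w) \<Longrightarrow> push_letter l w = l # w"
  by (cases w) auto

lemma foldr_push_Nil: "reduced w \<Longrightarrow> foldr push_letter w [] = w"
proof (induction w)
  case (Cons l w)
  then show ?case using reduced_ConsD[OF Cons.prems] by (simp add: reduced_Cons_push)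
qed simp

lemma foldr_push_push:
  "reduced w \<Longrightarrow>
    foldr push_letter (push_letter l u) w = push_letter l (foldr push_letter u w)"
  by (cases u) (auto simp: push_push_inv push_inv_push reduced_foldr_push)

lemma foldr_push_assoc:
  "reduced w \<Longrightarrow>
    foldr push_letter (foldr push_letter u v) w = foldr push_letter u (foldr push_letter v w)"
  by (induction u) (auto simp: foldr_push_push)

lemma foldr_push_inverse:
  "reduced v \<Longrightarrow> foldr push_letter (rev (map inv_letter u)) (foldr push_letter u v) = v"
proof (induction u arbitrary: v)
  case (Cons l u)
  then show ?case by (simp add: push_inv_push reduced_foldr_push)
qed simp

lemma group_free_group: "group (free_group X)"
proof (rule groupI)
  fix u v assume uv: "u \<in> carrier (free_group X)" "v \<in> carrier (free_group X)"
  then show "u \<otimes>\<^bsub>free_group X\<^esub> v \<in> carrier (free_group X)"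
    using set_foldr_push[of u v] by (fastforce simp: free_group_def reduced_foldr_push)
next
  fix u assume u: "u \<in> carrier (free_group X)"
  define u' where "u' = foldr push_letter (rev (map inv_letter u)) []"
  have "set u' \<subseteq> inv_letter ` set u"
    using set_foldr_push[of "rev (map inv_letter u)" "[]"] by (simp add: u'_def)
  then have "fst ` set u' \<subseteq> fst ` inv_letter ` set u" by (rule image_mono)
  then have "fst ` set u' \<subseteq> fst ` set u" by (simp add: image_image)
  moreover have "reduced u'" by (simp add: u'_def reduced_foldr_push)
  ultimately have "u' \<in> carrier (free_group X)"
    using u by (auto simp: free_group_def)
  moreover have "u' \<otimes>\<^bsub>free_group X\<^esub> u = \<one>\<^bsub>free_group X\<^esub>"
  proof -
    have "foldr push_letter u' u = foldr push_letter (rev (map inv_letter u)) (foldr push_letter u [])"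
      using u by (simp add: free_group_def u'_def foldr_push_assoc foldr_push_Nil)
    then show ?thesis by (simp add: free_group_def foldr_push_inverse)
  qed
  ultimately show "\<exists>y\<in>carrier (free_group X). y \<otimes>\<^bsub>free_group X\<^esub> u = \<one>\<^bsub>free_group X\<^esub>"
    by blast
qed (auto simp: free_group_def foldr_push_assoc)

lemma free_gen_closed: "x \<in> X \<Longrightarrow> free_gen x \<in> carrier (free_group X)"
  by (simp add: free_gen_def free_group_def)

lemma inv_free_gen:
  assumes "x \<in> X" shows "inv\<^bsub>free_group X\<^esub> (free_gen x) = [(x, False)]"
  by (rule group.inv_equality[OF group_free_group])
    (use assms in \<open>auto simp: free_gen_def free_group_def inv_letter_def\<close>)

subsection \<open>The universal property\<close>

text \<open>
  \<open>free_lift X G f\<close> is the unique homomorphism from the free group on \<open>X\<close> to \<open>G\<close> that takes each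
  generator \<open>x\<close> to \<open>f x\<close>; see \<open>free_lift_hom\<close>, \<open>free_lift_gen\<close> and \<open>free_lift_unique\<close>.
\<close>

definition eval_letter :: "('b, 'c) monoid_scheme \<Rightarrow> ('a \<Rightarrow> 'b) \<Rightarrow> 'a \<times> bool \<Rightarrow> 'b" where
  "eval_letter G f l = (if snd l then f (fst l) else inv\<^bsub>G\<^esub> (f (fst l)))"

definition free_lift ::
    "'a set \<Rightarrow> ('b, 'c) monoid_scheme \<Rightarrow> ('a \<Rightarrow> 'b) \<Rightarrow> ('a \<times> bool) list \<Rightarrow> 'b" where
  "free_lift X G f =
    (\<lambda>w\<in>carrier (free_group X). foldr (\<lambda>l g. eval_letter G f l \<otimes>\<^bsub>G\<^esub> g) w \<one>\<^bsub>G\<^esub>)"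

context group
begin

lemma eval_letter_closed:
  "f \<in> X \<rightarrow> carrier G \<Longrightarrow> fst l \<in> X \<Longrightarrow> eval_letter G f l \<in> carrier G"
  by (auto simp: eval_letter_def)

lemma eval_word_closed:
  assumes "f \<in> X \<rightarrow> carrier G" "fst ` set w \<subseteq> X"
  shows "foldr (\<lambda>l g. eval_letter G f l \<otimes> g) w \<one> \<in> carrier G"
  using assms(2) by (induction w) (auto simp: eval_letter_closed[OF assms(1)])

lemma eval_push:
  assumes "f \<in> X \<rightarrow> carrier G" "fst l \<in> X" "fst ` set w \<subseteq> X"
  shows "foldr (\<lambda>l g. eval_letter G f l \<otimes> g) (push_letter l w) \<one>
      = eval_letter G f l \<otimes> foldr (\<lambda>l g. eval_letter G f l \<otimes> g) w \<one>"
proof (cases w)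
  case (Cons k v)
  have v: "foldr (\<lambda>l g. eval_letter G f l \<otimes> g) v \<one> \<in> carrier G"
    using assms Cons by (intro eval_word_closed) auto
  have f: "f (fst l) \<in> carrier G" using assms by auto
  have "eval_letter G f (inv_letter l) = inv (eval_letter G f l)"
    using f by (auto simp: eval_letter_def inv_letter_def)
  then show ?thesis
    using v Cons eval_letter_closed[OF assms(1,2)]
    by (auto simp flip: m_assoc)
qed simp

lemma eval_foldr_push:
  assumes "f \<in> X \<rightarrow> carrier G" "fst ` set u \<subseteq> X" "fst ` set v \<subseteq> X"
  shows "foldr (\<lambda>l g. eval_letter G f l \<otimes> g) (foldr push_letter u v) \<one>
      = foldr (\<lambda>l g. eval_letter G f l \<otimes> g) u \<one>
        \<otimes> foldr (\<lambda>l g. eval_letter G f l \<otimes> g) v \<one>"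
  using assms(2)
proof (induction u)
  case Nil
  then show ?case using eval_word_closed[OF assms(1,3)] by simp
next
  case (Cons l u)
  have "fst ` set (foldr push_letter u v) \<subseteq> X"
    using set_foldr_push[of u v] Cons.prems assms(3) by fastforce
  then show ?case
    using Cons eval_push[OF assms(1), of l "foldr push_letter u v"]
      eval_word_closed[OF assms(1,3)] eval_word_closed[OF assms(1), of u]
      eval_letter_closed[OF assms(1), of l]
    by (simp add: m_assoc)
qed

lemma free_lift_hom:
  assumes "f \<in> X \<rightarrow> carrier G"
  shows "free_lift X G f \<in> hom (free_group X) G"
proof (rule homI)
  fix u assume "u \<in> carrier (free_group X)"
  then show "free_lift X G f u \<in> carrier G"
    using eval_word_closed[OF assms, of u] by (simp add: free_lift_def free_group_def)
next
  fix u v assume "u \<in> carrier (free_group X)" "v \<in> carrier (free_group X)"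
  moreover from this have "u \<otimes>\<^bsub>free_group X\<^esub> v \<in> carrier (free_group X)"
    by (simp add: group.is_monoid[OF group_free_group] monoid.m_closed)
  ultimately show "free_lift X G f (u \<otimes>\<^bsub>free_group X\<^esub> v) = free_lift X G f u \<otimes> free_lift X G f v"
    using eval_foldr_push[OF assms, of u v] by (simp add: free_lift_def free_group_def)
qed

lemma free_lift_gen:
  assumes "f \<in> X \<rightarrow> carrier G" "x \<in> X"
  shows "free_lift X G f (free_gen x) = f x"
proof -
  have "f x \<in> carrier G" using assms by auto
  then show ?thesis
    using free_gen_closed[OF assms(2)]
    by (simp add: free_lift_def free_gen_def eval_letter_def)
qed

lemma free_lift_unique:
  assumes f: "f \<in> X \<rightarrow> carrier G" and h: "h \<in> hom (free_group X) G"
    and ext: "h \<in> extensional (carrier (free_group X))"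
    and gen: "\<And>x. x \<in> X \<Longrightarrow> h (free_gen x) = f x"
  shows "h = free_lift X G f"
proof -
  interpret F: group "free_group X" by (rule group_free_group)
  interpret h: group_hom "free_group X" G h
    using h by (simp add: group_hom_def group_hom_axioms_def)
  have letter: "h [l] = eval_letter G f l" if "fst l \<in> X" for l
    using that gen[OF that] h.hom_inv[OF free_gen_closed[OF that]] inv_free_gen[OF that]
    by (cases l; cases "snd l") (auto simp: eval_letter_def free_gen_def)
  have "h w = foldr (\<lambda>l g. eval_letter G f l \<otimes> g) w \<one>" if "w \<in> carrier (free_group X)" for w
    using that
  proof (induction w)
    case Nil
    then show ?case using h.hom_one by (simp add: free_group_def)
  next
    case (Cons l w)
    then have w: "w \<in> carrier (free_group X)" and l: "[l] \<in> carrier (free_group X)"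
      and "fst l \<in> X" and "l # w = [l] \<otimes>\<^bsub>free_group X\<^esub> w"
      by (auto simp: free_group_def reduced_Cons_push dest: reduced_ConsD)
    then have "h (l # w) = eval_letter G f l \<otimes> h w"
      using h.hom_mult[OF l w] letter[of l] by metis
    then show ?case using Cons.IH[OF w] by simp
  qed
  then show ?thesis
    using ext by (intro extensionalityI[of _ "carrier (free_group X)"]) (auto simp: free_lift_def)
qed

end

section \<open>Subgroups of the automorphism group\<close>

definition Fix :: "('a, 'b) monoid_scheme \<Rightarrow> 'a set \<Rightarrow> ('a \<Rightarrow> 'a) set" where
  "Fix G Y = {\<phi> \<in> auto G. \<forall>y\<in>Y. \<phi> y = y}"

definition Fix_conj :: "('a, 'b) monoid_scheme \<Rightarrow> 'a set \<Rightarrow> ('a \<Rightarrow> 'a) set" where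
  "Fix_conj G Y =
    {\<phi> \<in> auto G. \<forall>y\<in>Y. \<exists>g\<in>carrier G. \<phi> y = g \<otimes>\<^bsub>G\<^esub> y \<otimes>\<^bsub>G\<^esub> inv\<^bsub>G\<^esub> g}"

section \<open>Whitehead automorphisms and elementary automorphisms of the free group of rank n\<close>

type_synonym fgelem = "(nat \<times> bool) list"

abbreviation Fn :: "nat \<Rightarrow> fgelem monoid" where
  "Fn n \<equiv> free_group {1..n}"

abbreviation gen :: "nat \<Rightarrow> fgelem" where
  "gen \<equiv> free_gen"

abbreviation endo :: "nat \<Rightarrow> (nat \<Rightarrow> fgelem) \<Rightarrow> fgelem \<Rightarrow> fgelem" where
  "endo n f \<equiv> free_lift {1..n} (Fn n) f"

definition signed_gens :: "nat \<Rightarrow> fgelem set" where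
  "signed_gens n = gen ` {1..n} \<union> (\<lambda>i. inv\<^bsub>Fn n\<^esub> (gen i)) ` {1..n}"

definition whitehead_type1 :: "nat \<Rightarrow> (fgelem \<Rightarrow> fgelem) set" where
  "whitehead_type1 n =
    {\<phi> \<in> auto (Fn n). \<exists>\<sigma> \<epsilon>. \<sigma> permutes {1..n} \<and> \<epsilon> \<in> {1..n} \<rightarrow> {1, -1 :: int} \<and>
       (\<forall>i\<in>{1..n}. \<phi> (gen i) = gen (\<sigma> i) [^]\<^bsub>Fn n\<^esub> \<epsilon> i)}"

definition whitehead_auto :: "nat \<Rightarrow> fgelem set \<Rightarrow> fgelem \<Rightarrow> fgelem \<Rightarrow> fgelem" where
  "whitehead_auto n A a = endo n (\<lambda>j.
     if gen j = a \<or> gen j = inv\<^bsub>Fn n\<^esub> a then gen j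
     else a [^]\<^bsub>Fn n\<^esub> (indicator A (gen j) :: int) \<otimes>\<^bsub>Fn n\<^esub> gen j
          \<otimes>\<^bsub>Fn n\<^esub> a [^]\<^bsub>Fn n\<^esub> (- indicator A (inv\<^bsub>Fn n\<^esub> (gen j)) :: int))"

definition whitehead_type2 :: "nat \<Rightarrow> (fgelem \<Rightarrow> fgelem) set" where
  "whitehead_type2 n =
    {whitehead_auto n A a | A a.
       a \<in> signed_gens n \<and> A \<subseteq> signed_gens n \<and> a \<in> A \<and> inv\<^bsub>Fn n\<^esub> a \<notin> A}"

definition whitehead :: "nat \<Rightarrow> (fgelem \<Rightarrow> fgelem) set" where
  "whitehead n = whitehead_type1 n \<union> whitehead_type2 n"

definition S_aut :: "nat \<Rightarrow> nat \<Rightarrow> fgelem \<Rightarrow> fgelem" where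
  "S_aut n i = endo n (\<lambda>k. if k = i then inv\<^bsub>Fn n\<^esub> (gen i) else gen k)"

definition rho :: "nat \<Rightarrow> nat \<Rightarrow> nat \<Rightarrow> fgelem \<Rightarrow> fgelem" where
  "rho n i j = endo n (\<lambda>k. if k = i then gen i \<otimes>\<^bsub>Fn n\<^esub> gen j else gen k)"

definition K_aut :: "nat \<Rightarrow> nat \<Rightarrow> nat \<Rightarrow> fgelem \<Rightarrow> fgelem" where
  "K_aut n i j = endo n (\<lambda>k.
     if k = i then gen j \<otimes>\<^bsub>Fn n\<^esub> gen i \<otimes>\<^bsub>Fn n\<^esub> inv\<^bsub>Fn n\<^esub> (gen j) else gen k)"

definition gens_A :: "nat \<Rightarrow> nat \<Rightarrow> (fgelem \<Rightarrow> fgelem) set" where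
  "gens_A n m =
    {S_aut n i | i. 1 \<le> i \<and> i \<le> m} \<union>
    {rho n i j | i j. 1 \<le> i \<and> i \<le> m \<and> 1 \<le> j \<and> j \<le> n \<and> i \<noteq> j}"

definition gens_B :: "nat \<Rightarrow> nat \<Rightarrow> (fgelem \<Rightarrow> fgelem) set" where
  "gens_B n m =
    gens_A n m \<union>
    {K_aut n i j | i j. m + 1 \<le> i \<and> i \<le> n \<and> 1 \<le> j \<and> j \<le> n \<and> i \<noteq> j}"

end

theory Submission
  imports Defs
begin

text \<open>
  An automorphism \<open>\<phi>\<close> is determined by the tuple of basis images \<open>u\<^sub>k\<close> of the \<open>x\<^sub>k\<close>, and multiplying
  \<open>\<phi>\<close> on the right by one of the given generators or its inverse performs a Nielsen move on this
  tuple: some \<open>u\<^sub>j\<close> with \<open>j \<le> m\<close> is inverted or multiplied by another entry or its inverse, or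
  some \<open>u\<^sub>j\<close> with \<open>j > m\<close> is conjugated by another entry or its inverse. The proof is Nielsen's
  reduction method, carried out with these moves only.

  If \<open>\<phi>\<close> takes \<open>x\<^sub>j\<close> to a conjugate for all \<open>j > m\<close>, then \<open>u\<^sub>j = h x\<^sub>j h\<^sup>-\<^sup>1\<close> is a reduced word with
  the letter \<open>x\<^sub>j\<close> in the middle, and conjugation acts by multiplying \<open>h\<close>. Moves are applied as
  long as they decrease a well-founded order on tuples, which compares lengths and breaks ties by
  the initial halves of the words and their inverses. When no move applies, at most half of an
  entry cancels against a neighbour in a product of entries
  (\<open>irreducible_family.common_prefix_at_most_half\<close>): if an entry with \<open>j > m\<close> were to lose more,
  then either \<open>h\<close> could be shortened, or two different middle letters would coincide. Moreover, no
  entry cancels completely between its neighbours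
  (\<open>irreducible_family.no_complete_cancellation\<close>): such an entry \<open>p q\<^sup>-\<^sup>1\<close> has halves of equal
  length and allows one to exchange a prefix of another entry for a smaller one, within the first
  half of an ordinary entry or within \<open>h\<close>. Consequently every factor leaves a remainder in a
  product (\<open>nielsen_product_length\<close>), so \<open>\<phi> w\<close> is at least as long as \<open>w\<close>. As every \<open>x\<^sub>k\<close> is of
  the form \<open>\<phi> w\<close>, the tuple is a signed permutation of the basis that fixes \<open>x\<^sub>j\<close> for \<open>j > m\<close>, and
  these are products of elements of \<open>gens_A\<close>.

  The descent treats both stabilisers at once. If \<open>\<phi>\<close> fixes all \<open>x\<^sub>j\<close> with \<open>j > m\<close>, then every \<open>h\<close> is
  empty and cannot become smaller, so no conjugation is ever applied and \<open>gens_A\<close> suffices.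

  Finally, \<open>S_aut\<close>, \<open>rho\<close> and \<open>K_aut\<close> are themselves Whitehead automorphisms, so the subgroup
  generated by the Whitehead automorphisms in a stabiliser lies between the subgroup generated by
  \<open>gens_A\<close> or \<open>gens_B\<close> and the stabiliser.
\<close>

section \<open>Words and free reduction\<close>

abbreviation word_inv :: "('a \<times> bool) list \<Rightarrow> ('a \<times> bool) list" where
  "word_inv w \<equiv> rev (map inv_letter w)"

text \<open>The reduced word that represents \<open>w\<close> in the free group.\<close>

definition nf :: "('a \<times> bool) list \<Rightarrow> ('a \<times> bool) list" where
  "nf w = foldr push_letter w []"

lemma word_inv_word_inv [simp]: "word_inv (word_inv w) = w"
  by (simp add: rev_map comp_def)

lemma inv_letter_eq_iff: "inv_letter k = l \<longleftrightarrow> k = inv_letter l"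
  by (metis inv_letter_simps(1))

lemma word_inv_eq_iff: "word_inv u = v \<longleftrightarrow> u = word_inv v"
  by (metis word_inv_word_inv)

lemma reduced_iff_successively: "reduced w \<longleftrightarrow> successively (\<lambda>k l. k \<noteq> inv_letter l) w"
  by (induction w rule: reduced.induct) auto

lemma reduced_append_iff:
  "reduced (u @ v) \<longleftrightarrow>
    reduced u \<and> reduced v \<and> (u = [] \<or> v = [] \<or> last u \<noteq> inv_letter (hd v))"
  by (simp add: reduced_iff_successively successively_append_iff)

lemma reduced_word_inv [simp]: "reduced (word_inv w) \<longleftrightarrow> reduced w"
  by (auto simp: reduced_iff_successively successively_map inv_letter_eq_iff
      elim!: successively_mono)

lemma reduced_nf [simp]: "reduced (nf w)"
  by (simp add: nf_def reduced_foldr_push)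

lemma nf_reduced [simp]: "reduced w \<Longrightarrow> nf w = w"
  by (simp add: nf_def foldr_push_Nil)

lemma nf_Nil [simp]: "nf [] = []"
  by (simp add: nf_def)

lemma foldr_push_eq_nf: "reduced v \<Longrightarrow> foldr push_letter u v = nf (u @ v)"
  by (simp add: nf_def foldr_push_Nil)

lemma nf_append_nf_right [simp]: "nf (u @ nf v) = nf (u @ v)"
  by (simp add: nf_def foldr_push_Nil reduced_foldr_push)

lemma nf_append_nf_left [simp]: "nf (nf u @ v) = nf (u @ v)"
  using foldr_push_assoc[of "nf v" u "[]"] by (simp add: foldr_push_eq_nf flip: nf_def)

lemma nf_cong_append: "nf u = nf u' \<Longrightarrow> nf v = nf v' \<Longrightarrow> nf (u @ v) = nf (u' @ v')"
  by (metis nf_append_nf_left nf_append_nf_right)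

lemma nf_cancel_front: "nf (p @ word_inv p @ v) = nf v"
proof -
  have "foldr push_letter (word_inv (word_inv p)) (foldr push_letter (word_inv p) (nf v)) = nf v"
    by (intro foldr_push_inverse) simp
  then show ?thesis
    by (simp only: word_inv_word_inv) (simp add: foldr_push_eq_nf reduced_foldr_push)
qed

lemma nf_cancel: "nf (u @ p @ word_inv p @ v) = nf (u @ v)"
  by (rule nf_cong_append) (simp_all add: nf_cancel_front)

lemma nf_cancel': "nf (u @ word_inv p @ p @ v) = nf (u @ v)"
  using nf_cancel[of u "word_inv p" v] by simp

lemma length_push_letter: "length (push_letter l w) \<le> Suc (length w)"
  by (cases w) auto

lemma length_nf_le: "length (nf w) \<le> length w"
  unfolding nf_def
proof (induction w)
  case (Cons l w)
  then show ?case using length_push_letter[of l "foldr push_letter w []"] by simp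
qed simp

text \<open>Reduction deletes cancelling pairs only, so a word that keeps its length is unchanged.\<close>

lemma nf_eq_if_length_eq: "length (nf w) = length w \<Longrightarrow> nf w = w"
proof (induction w)
  case (Cons l w)
  have push: "nf (l # w) = push_letter l (nf w)" by (simp add: nf_def)
  then have "length (nf w) = length w"
    using Cons.prems length_nf_le[of w] length_push_letter[of l "nf w"] by simp
  then have w: "nf w = w" by (rule Cons.IH)
  show ?case using Cons.prems unfolding push w by (cases w) (auto split: if_splits)
qed simp

lemma set_nf: "set (nf w) \<subseteq> set w"
  using set_foldr_push[of w "[]"] by (simp add: nf_def)

text \<open>
  The word \<open>word_inv (nf w) @ w\<close> reduces to the empty word, and inverses are unique.
\<close>

lemma nf_word_inv: "nf (word_inv w) = word_inv (nf w)"
proof -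
  have "nf (word_inv (nf w) @ w) = nf (word_inv (nf w) @ nf w)" by simp
  also have "\<dots> = []" using nf_cancel'[of "[]" "nf w" "[]"] by simp
  finally have eq: "nf (word_inv (nf w) @ w) = []" .
  have "word_inv (nf w) = nf (word_inv (nf w) @ w @ word_inv w)"
    using nf_cancel[of "word_inv (nf w)" w "[]"] by simp
  also have "\<dots> = nf (nf (word_inv (nf w) @ w) @ word_inv w)" by simp
  finally show ?thesis by (simp add: eq)
qed

lemma maximal_common_prefix:
  "\<exists>p u' v'. u = p @ u' \<and> v = p @ v' \<and> (u' = [] \<or> v' = [] \<or> hd u' \<noteq> hd v')"
proof (induction u arbitrary: v)
  case (Cons a u)
  show ?case
  proof (cases "v \<noteq> [] \<and> hd v = a")
    case True
    then obtain v1 where "v = a # v1" by (cases v) auto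
    moreover obtain p u' v' where
      "u = p @ u'" "v1 = p @ v'" "u' = [] \<or> v' = [] \<or> hd u' \<noteq> hd v'"
      using Cons.IH[of v1] by blast
    ultimately have "a # u = (a # p) @ u' \<and> v = (a # p) @ v' \<and>
        (u' = [] \<or> v' = [] \<or> hd u' \<noteq> hd v')" by simp
    then show ?thesis by blast
  next
    case False
    then have "a # u = [] @ (a # u) \<and> v = [] @ v \<and> (a # u = [] \<or> v = [] \<or> hd (a # u) \<noteq> hd v)"
      by auto
    then show ?thesis by blast
  qed
qed simp

text \<open>
  In odd length the middle letter of \<open>u\<close> would be its own inverse; in even length its two middle
  letters would cancel.
\<close>

lemma no_half_self_inverse:
  assumes red: "reduced u" and u: "u = p @ u1" and inv: "word_inv u = p @ u2"
    and half: "length u \<le> 2 * length p"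
  shows "u = []"
proof (rule ccontr)
  assume "u \<noteq> []"
  define L where "L = length u"
  have "L > 0" using \<open>u \<noteq> []\<close> by (simp add: L_def)
  have len: "length p \<le> L" by (simp add: L_def u)
  have nth: "u ! i = inv_letter (u ! (L - Suc i))" if "i < length p" for i
  proof -
    have "u ! i = word_inv u ! i" using that by (simp add: inv nth_append) (simp add: u nth_append)
    then show ?thesis using that len by (simp add: rev_nth L_def)
  qed
  show False
  proof (cases "even L")
    case True
    then obtain k where k: "L = 2 * k" by auto
    then have "k - 1 < length p" and "k > 0" using half \<open>L > 0\<close> by (auto simp: L_def)
    then have "u ! (k - 1) = inv_letter (u ! Suc (k - 1))"
      using nth[of "k - 1"] k by (simp add: mult_2)
    moreover have "Suc (k - 1) < length u" using k \<open>k > 0\<close> by (simp add: L_def)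
    ultimately show False
      using red successively_nth[of "\<lambda>k l. k \<noteq> inv_letter l" u "k - 1"]
      by (simp add: reduced_iff_successively)
  next
    case False
    then obtain k where k: "L = 2 * k + 1" by (auto elim: oddE)
    then have "k < length p" using half by (simp add: L_def)
    then show False using nth[of k] k inv_letter_simps(4)[of "u ! k"] by simp
  qed
qed

section \<open>Nielsen reduced families\<close>

text \<open>
  Every factor of a product of \<open>U\<close>-values along a reduced word leaves a nonempty remainder: by
  \<open>half\<close>, at most half of it cancels against either neighbour, and by \<open>core\<close> the two halves do not
  both disappear. So such a product is at least as long as the word, and Nielsen's length estimate
  follows by adding factors in front. For the induction, \<open>r\<close> is the part of the first factor that
  survives and \<open>t\<close> the part that cancels against the second one: a further factor in front cancels
  less than \<open>r\<close>, so the two cancellations stay apart.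
  
  Both hypotheses speak of common prefixes, as \<open>U l\<close> cancels against \<open>U b\<close> by as much as
  \<open>U (inv_letter l)\<close> and \<open>U b\<close> have in common.
\<close>

lemma nielsen_product_length:
  fixes U :: "'a \<times> bool \<Rightarrow> ('b \<times> bool) list"
  assumes U_inv: "\<And>l. l \<in> L \<Longrightarrow> U (inv_letter l) = word_inv (U l)"
    and L_inv: "\<And>l. l \<in> L \<Longrightarrow> inv_letter l \<in> L"
    and U_red: "\<And>l. l \<in> L \<Longrightarrow> reduced (U l)"
    and U_ne: "\<And>l. l \<in> L \<Longrightarrow> U l \<noteq> []"
    and half: "\<And>a b p a' b'. \<lbrakk>a \<in> L; b \<in> L; a \<noteq> b; U a = p @ a'; U b = p @ b'\<rbrakk>
        \<Longrightarrow> 2 * length p \<le> length (U a)"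
    and core: "\<And>a b c p q a' c'. \<lbrakk>a \<in> L; b \<in> L; c \<in> L; a \<noteq> b; c \<noteq> inv_letter b;
        U a = p @ a'; U b = p @ word_inv q; U c = q @ c'\<rbrakk> \<Longrightarrow> False"
  shows "reduced (l # w) \<Longrightarrow> set (l # w) \<subseteq> L \<Longrightarrow>
    \<exists>r s t. nf (concat (map U (l # w))) = r @ s \<and> U l = r @ t \<and> r \<noteq> [] \<and> length w \<le> length s \<and>
      (t = [] \<or> w \<noteq> [] \<and> (\<exists>c'. U (hd w) = word_inv t @ c'))"
proof (induction w arbitrary: l)
  case Nil
  then show ?case using U_ne[of l] U_red[of l] by (intro exI[of _ "U l"] exI[of _ "[]"]) auto
next
  case (Cons b w)
  have lL: "l \<in> L" and bL: "b \<in> L" and lb: "inv_letter l \<noteq> b"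
    using Cons.prems by (auto simp: inv_letter_eq_iff)
  have red: "reduced (b # w)" using Cons.prems by simp
  obtain r s t where IH: "nf (concat (map U (b # w))) = r @ s" "U b = r @ t" "r \<noteq> []"
    "length w \<le> length s" "t = [] \<or> w \<noteq> [] \<and> (\<exists>c'. U (hd w) = word_inv t @ c')"
    using Cons.IH[OF red] Cons.prems(2) by (metis set_subset_Cons subset_trans)
  obtain p a' b' where p: "U (inv_letter l) = p @ a'" "U b = p @ b'"
    "a' = [] \<or> b' = [] \<or> hd a' \<noteq> hd b'"
    using maximal_common_prefix by blast
  have pl: "2 * length p \<le> length (U (inv_letter l))"
    using half[of "inv_letter l" b p a' b'] lL bL lb p L_inv by auto
  have pb: "2 * length p \<le> length (U b)"
    using half[of b "inv_letter l" p b' a'] lL bL lb p L_inv by auto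
  have "a' \<noteq> []" using pl p(1) U_ne[OF L_inv[OF lL]] by auto
  \<comment> \<open>The cancellations on the two sides of \<open>U b\<close> do not meet.\<close>
  have "length p < length r"
  proof (cases "t = []")
    case True
    then show ?thesis using pb U_ne[OF bL] IH(2) by (cases "U b") auto
  next
    case False
    then obtain c' where w: "w \<noteq> []" and c': "U (hd w) = word_inv t @ c'" using IH(5) by blast
    let ?c = "hd w"
    have cL: "?c \<in> L" using Cons.prems(2) w by (cases w) auto
    have bc: "?c \<noteq> inv_letter b" using red w by (cases w) (auto simp: inv_letter_eq_iff)
    have invb: "U (inv_letter b) = word_inv t @ word_inv r" using U_inv[OF bL] IH(2) by simp
    have "2 * length (word_inv t) \<le> length (U (inv_letter b))"
      using half[OF L_inv[OF bL] cL _ invb c'] bc by auto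
    then have tb: "2 * length t \<le> length (U b)" using U_inv[OF bL] by simp
    have "length p + length t \<noteq> length (U b)"
    proof
      assume eq: "length p + length t = length (U b)"
      have "r = p"
        using IH(2) p(2) eq by (metis add_right_cancel append_eq_append_conv length_append)
      then have "U b = p @ word_inv (word_inv t)" using IH(2) by simp
      from core[OF L_inv[OF lL] bL cL lb bc p(1) this c'] show False .
    qed
    then have "length p + length t < length (U b)" using tb pb by simp
    then show ?thesis using IH(2) by simp
  qed
  then obtain r' where r': "r = p @ r'" "r' \<noteq> []"
    using IH(2) p(2) by (metis append_eq_append_conv2 append_Nil2 length_append
        less_irrefl not_add_less1 linorder_not_le le_add1)
  have hd: "hd a' \<noteq> hd r'"
    using p(2,3) IH(2) r' \<open>a' \<noteq> []\<close> by auto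
  have Ul: "U l = word_inv a' @ word_inv p" using U_inv[OF lL] p(1) by (simp add: word_inv_eq_iff[symmetric])
  have "reduced (p @ (r' @ s))"
    using reduced_nf[of "concat (map U (b # w))"] unfolding IH(1) r'(1) by simp
  then have "reduced (r' @ s)" by (subst (asm) reduced_append_iff) blast
  moreover have "reduced (word_inv a')" using U_red[OF lL] Ul by (simp add: reduced_append_iff)
  ultimately have "reduced (word_inv a' @ r' @ s)"
    using hd \<open>a' \<noteq> []\<close> r'(2)
    by (subst reduced_append_iff) (auto simp: last_rev hd_map)
  then have red: "nf (word_inv a' @ r' @ s) = word_inv a' @ r' @ s" by simp
  have "nf (concat (map U (l # b # w))) = nf (U l @ nf (concat (map U (b # w))))" by simp
  also have "\<dots> = nf (word_inv a' @ word_inv p @ p @ r' @ s)" unfolding IH(1) Ul r'(1) by simp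
  also have "\<dots> = nf (word_inv a' @ r' @ s)" by (simp only: nf_cancel')
  finally have "nf (concat (map U (l # b # w))) = word_inv a' @ r' @ s" unfolding red .
  moreover have "length (b # w) \<le> length (r' @ s)" using IH(4) r'(2) by (cases r') auto
  moreover have "\<exists>c'. U (hd (b # w)) = word_inv (word_inv p) @ c'" using p(2) by simp
  moreover have "word_inv a' \<noteq> []" using \<open>a' \<noteq> []\<close> by simp
  ultimately show ?case using Ul by blast
qed

section \<open>Endomorphisms and automorphisms of free groups\<close>

lemma carrier_free_group: "w \<in> carrier (free_group X) \<longleftrightarrow> reduced w \<and> fst ` set w \<subseteq> X"
  by (simp add: free_group_def)

lemma one_free_group: "\<one>\<^bsub>free_group X\<^esub> = []"
  by (simp add: free_group_def)

lemma mult_free_group: "reduced v \<Longrightarrow> u \<otimes>\<^bsub>free_group X\<^esub> v = nf (u @ v)"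
  by (simp add: free_group_def foldr_push_eq_nf)

lemma nf_in_free_group: "fst ` set w \<subseteq> X \<Longrightarrow> nf w \<in> carrier (free_group X)"
  using set_nf[of w] by (auto simp: carrier_free_group)

lemma inv_free_group:
  assumes "u \<in> carrier (free_group X)"
  shows "inv\<^bsub>free_group X\<^esub> u = word_inv u"
proof (rule group.inv_equality[OF group_free_group])
  have red: "reduced u" using assms by (simp add: carrier_free_group)
  then show "word_inv u \<otimes>\<^bsub>free_group X\<^esub> u = \<one>\<^bsub>free_group X\<^esub>"
    using nf_cancel'[of "[]" u "[]"] by (simp add: mult_free_group one_free_group)
  show "word_inv u \<in> carrier (free_group X)"
    using assms by (simp add: carrier_free_group image_image)
qed (rule assms)

lemma letter_in_free_group: "fst l \<in> X \<Longrightarrow> [l] \<in> carrier (free_group X)"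
  by (simp add: carrier_free_group)

text \<open>A homomorphism may be applied letter by letter, before or after free reduction.\<close>

lemma hom_nf:
  assumes \<phi>: "\<phi> \<in> hom (free_group X) (free_group Z)" and w: "fst ` set w \<subseteq> X"
  shows "\<phi> (nf w) = nf (concat (map (\<lambda>l. \<phi> [l]) w))"
  using w
proof (induction w)
  case Nil
  then show ?case
    using hom_one[OF \<phi> group_free_group group_free_group] by (simp add: one_free_group)
next
  case (Cons l w)
  have cl: "[l] \<in> carrier (free_group X)" "nf w \<in> carrier (free_group X)"
    using Cons.prems by (auto intro: letter_in_free_group nf_in_free_group)
  have "\<phi> (nf w) \<in> carrier (free_group Z)" by (rule hom_in_carrier[OF \<phi> cl(2)])
  then have red: "reduced (\<phi> (nf w))" by (simp add: carrier_free_group)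
  have "\<phi> (nf (l # w)) = \<phi> ([l] \<otimes>\<^bsub>free_group X\<^esub> nf w)"
    using nf_append_nf_right[of "[l]" w] by (simp add: mult_free_group)
  also have "\<dots> = nf (\<phi> [l] @ \<phi> (nf w))"
    using hom_mult[OF \<phi> cl] red by (simp add: mult_free_group)
  also have "\<dots> = nf (\<phi> [l] @ concat (map (\<lambda>l. \<phi> [l]) w))"
    using Cons by simp
  finally show ?case by simp
qed

lemma hom_nf_append:
  assumes "\<phi> \<in> hom (free_group X) (free_group Z)" "fst ` set u \<subseteq> X" "fst ` set v \<subseteq> X"
  shows "\<phi> (nf (u @ v)) = nf (\<phi> (nf u) @ \<phi> (nf v))"
  using hom_nf[OF assms(1), of "u @ v"] hom_nf[OF assms(1), of u] hom_nf[OF assms(1), of v] assms(2,3)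
  by (simp add: image_Un)

lemma hom_word_inv:
  assumes \<phi>: "\<phi> \<in> hom (free_group X) (free_group Z)" and u: "u \<in> carrier (free_group X)"
  shows "\<phi> (word_inv u) = word_inv (\<phi> u)"
proof -
  interpret group_hom "free_group X" "free_group Z" \<phi>
    using \<phi> by (simp add: group_hom_def group_hom_axioms_def group_free_group)
  show ?thesis using hom_inv[OF u] u by (simp add: inv_free_group)
qed

lemma auto_hom: "\<phi> \<in> auto G \<Longrightarrow> \<phi> \<in> hom G G"
  by (simp add: auto_def)

lemma auto_closed: "\<phi> \<in> auto G \<Longrightarrow> x \<in> carrier G \<Longrightarrow> \<phi> x \<in> carrier G"
  by (rule hom_in_carrier[OF auto_hom])

lemma auto_inj_on: "\<phi> \<in> auto G \<Longrightarrow> inj_on \<phi> (carrier G)"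
  by (auto simp: auto_def Bij_def bij_betw_def)

lemma auto_surj: "\<phi> \<in> auto G \<Longrightarrow> \<phi> ` carrier G = carrier G"
  by (auto simp: auto_def Bij_def bij_betw_def)

lemma carrier_AutoGroup: "carrier (AutoGroup G) = auto G"
  by (simp add: AutoGroup_def)

lemma one_AutoGroup: "\<one>\<^bsub>AutoGroup G\<^esub> = (\<lambda>x\<in>carrier G. x)"
  by (simp add: AutoGroup_def BijGroup_def)

lemma mult_AutoGroup:
  "\<phi> \<in> auto G \<Longrightarrow> \<psi> \<in> auto G \<Longrightarrow> \<phi> \<otimes>\<^bsub>AutoGroup G\<^esub> \<psi> = compose (carrier G) \<phi> \<psi>"
  by (simp add: AutoGroup_def BijGroup_def auto_def)

lemma mult_AutoGroup_apply:
  "\<phi> \<in> auto G \<Longrightarrow> \<psi> \<in> auto G \<Longrightarrow> x \<in> carrier G \<Longrightarrow>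
    (\<phi> \<otimes>\<^bsub>AutoGroup G\<^esub> \<psi>) x = \<phi> (\<psi> x)"
  by (simp add: mult_AutoGroup compose_def)

lemma group_AutoGroup_free: "group (AutoGroup (free_group X))"
  by (rule group.AutoGroup[OF group_free_group])

text \<open>
  This is the uniqueness part of the universal property, in the form in which identities between
  automorphisms are checked below.
\<close>

lemma hom_ext_gen:
  assumes "\<phi> \<in> hom (free_group X) (free_group X)" "\<phi> \<in> extensional (carrier (free_group X))"
    and "\<psi> \<in> hom (free_group X) (free_group X)" "\<psi> \<in> extensional (carrier (free_group X))"
    and "\<And>x. x \<in> X \<Longrightarrow> \<phi> (free_gen x) = \<psi> (free_gen x)"
  shows "\<phi> = \<psi>"
proof -
  have f: "(\<lambda>x. \<psi> (free_gen x)) \<in> X \<rightarrow> carrier (free_group X)"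
    by (intro funcsetI hom_in_carrier[OF assms(3)] free_gen_closed)
  have "\<phi> = free_lift X (free_group X) (\<lambda>x. \<psi> (free_gen x))"
    by (rule group.free_lift_unique[OF group_free_group f assms(1,2)]) (rule assms(5))
  moreover have "\<psi> = free_lift X (free_group X) (\<lambda>x. \<psi> (free_gen x))"
    by (rule group.free_lift_unique[OF group_free_group f assms(3,4)]) (rule refl)
  ultimately show ?thesis by simp
qed

lemma auto_ext_gen:
  assumes "\<phi> \<in> auto (free_group X)" "\<psi> \<in> auto (free_group X)"
    and "\<And>x. x \<in> X \<Longrightarrow> \<phi> (free_gen x) = \<psi> (free_gen x)"
  shows "\<phi> = \<psi>"
  using hom_ext_gen[of \<phi> X \<psi>] assms by (simp add: auto_def Bij_def)

lemma free_lift_extensional: "free_lift X G f \<in> extensional (carrier (free_group X))"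
  by (simp add: free_lift_def)

lemma free_lift_auto:
  assumes f: "f \<in> X \<rightarrow> carrier (free_group X)" and g: "g \<in> X \<rightarrow> carrier (free_group X)"
    and fg: "\<And>x. x \<in> X \<Longrightarrow> free_lift X (free_group X) f (g x) = free_gen x"
    and gf: "\<And>x. x \<in> X \<Longrightarrow> free_lift X (free_group X) g (f x) = free_gen x"
  shows "free_lift X (free_group X) f \<in> auto (free_group X)"
proof -
  let ?F = "free_group X"
  let ?f = "free_lift X ?F f" and ?g = "free_lift X ?F g"
  have hom: "?f \<in> hom ?F ?F" "?g \<in> hom ?F ?F"
    using f g by (auto intro: group.free_lift_hom[OF group_free_group])
  have id: "compose (carrier ?F) h k = (\<lambda>x\<in>carrier ?F. x)"
    if "h \<in> hom ?F ?F" "k \<in> hom ?F ?F" "\<And>x. x \<in> X \<Longrightarrow> h (k (free_gen x)) = free_gen x"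
    for h k
  proof (rule hom_ext_gen)
    show "compose (carrier ?F) h k \<in> hom ?F ?F"
      by (rule group.hom_compose[OF group_free_group that(2,1)])
    show "(\<lambda>x\<in>carrier ?F. x) \<in> hom ?F ?F"
      using group.id_in_auto[OF group_free_group] by (rule auto_hom)
  qed (use that(3) free_gen_closed in \<open>auto simp: compose_def\<close>)
  have c: "compose (carrier ?F) ?f ?g = (\<lambda>x\<in>carrier ?F. x)"
    "compose (carrier ?F) ?g ?f = (\<lambda>x\<in>carrier ?F. x)"
    using f g fg gf hom by (auto intro!: id simp: group.free_lift_gen[OF group_free_group])
  have "?f (?g x) = x" "?g (?f x) = x" if "x \<in> carrier ?F" for x
    using fun_cong[OF c(1), of x] fun_cong[OF c(2), of x] that by (auto simp: compose_def)
  then have "bij_betw ?f (carrier ?F) (carrier ?F)"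
    using hom_in_carrier[OF hom(1)] hom_in_carrier[OF hom(2)]
    by (intro bij_betw_byWitness[of _ ?g]) auto
  then show ?thesis using hom(1) by (simp add: auto_def Bij_def free_lift_extensional)
qed

subsection \<open>Elementary automorphisms\<close>

text \<open>
  The basis element \<open>j\<close> is multiplied on both sides by words \<open>u\<close>, \<open>v\<close> in the other basis elements.
  This covers \<open>rho\<close> (with \<open>u\<close> empty), \<open>K_aut\<close> (with \<open>v\<close> inverse to \<open>u\<close>) and the inverses of these.
\<close>

definition transvection ::
    "'a set \<Rightarrow> ('a \<times> bool) list \<Rightarrow> 'a \<Rightarrow> ('a \<times> bool) list \<Rightarrow> ('a \<times> bool) list \<Rightarrow> ('a \<times> bool) list"
  where "transvection X u j v = free_lift X (free_group X)
    (\<lambda>k. if k = j then nf (u @ [(j, True)] @ v) else free_gen k)"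

lemma concat_map_singleton: "concat (map (\<lambda>l. [l]) w) = w"
  by (induction w) auto

lemma hom_fixes_word:
  assumes \<phi>: "\<phi> \<in> hom (free_group X) (free_group X)" and w: "w \<in> carrier (free_group X)"
    and fixed: "\<And>x. x \<in> fst ` set w \<Longrightarrow> \<phi> (free_gen x) = free_gen x"
  shows "\<phi> w = w"
proof -
  have "\<phi> [l] = [l]" if "l \<in> set w" for l
  proof (cases l)
    case (Pair x s)
    have x: "\<phi> [(x, True)] = [(x, True)]" using fixed[of x] that Pair by (force simp: free_gen_def)
    have "x \<in> X" using w that Pair by (force simp: carrier_free_group)
    then have "\<phi> (word_inv [(x, True)]) = word_inv [(x, True)]"
      using x hom_word_inv[OF \<phi>, of "[(x, True)]"] by (simp add: letter_in_free_group)
    then show ?thesis using x Pair by (cases s) (auto simp: inv_letter_def)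
  qed
  then have "map (\<lambda>l. \<phi> [l]) w = map (\<lambda>l. [l]) w" by simp
  then have "concat (map (\<lambda>l. \<phi> [l]) w) = w" by (simp only: concat_map_singleton)
  then show ?thesis
    using hom_nf[OF \<phi>, of w] w by (simp add: carrier_free_group)
qed

context
  fixes X :: "'a set" and u v :: "('a \<times> bool) list" and j :: 'a
  assumes u: "reduced u" "fst ` set u \<subseteq> X - {j}" and v: "reduced v" "fst ` set v \<subseteq> X - {j}"
    and j: "j \<in> X"
begin

lemma transvection_funcset:
  "(\<lambda>k. if k = j then nf (u @ [(j, True)] @ v) else free_gen k) \<in> X \<rightarrow> carrier (free_group X)"
proof -
  have "fst ` set (u @ [(j, True)] @ v) \<subseteq> X" using u(2) v(2) j by (simp add: image_Un) blast
  from nf_in_free_group[OF this] show ?thesis by (simp add: Pi_iff free_gen_closed)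
qed

lemma transvection_hom: "transvection X u j v \<in> hom (free_group X) (free_group X)"
  unfolding transvection_def
  by (rule group.free_lift_hom[OF group_free_group transvection_funcset])

lemma transvection_gen:
  "k \<in> X \<Longrightarrow> transvection X u j v (free_gen k) =
    (if k = j then nf (u @ [(j, True)] @ v) else free_gen k)"
  unfolding transvection_def
  by (rule group.free_lift_gen[OF group_free_group transvection_funcset])

lemma transvection_fixes:
  assumes "reduced w" "fst ` set w \<subseteq> X - {j}"
  shows "transvection X u j v w = w"
proof (rule hom_fixes_word[OF transvection_hom])
  show "w \<in> carrier (free_group X)" using assms by (auto simp: carrier_free_group)
  fix x assume "x \<in> fst ` set w"
  then have "x \<in> X - {j}" using assms(2) by blast
  then show "transvection X u j v (free_gen x) = free_gen x"
    using transvection_gen[of x] by simp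
qed

lemma transvection_word:
  assumes "reduced w1" "fst ` set w1 \<subseteq> X - {j}" "reduced w2" "fst ` set w2 \<subseteq> X - {j}"
  shows "transvection X u j v (nf (w1 @ [(j, True)] @ w2)) = nf (w1 @ u @ [(j, True)] @ v @ w2)"
proof -
  note h = transvection_hom
  have "transvection X u j v (nf (w1 @ [(j, True)] @ w2))
      = nf (transvection X u j v w1 @ transvection X u j v (nf ([(j, True)] @ w2)))"
    using hom_nf_append[OF h, of w1 "[(j, True)] @ w2"] assms j by auto
  also have "transvection X u j v (nf ([(j, True)] @ w2))
      = nf (transvection X u j v [(j, True)] @ transvection X u j v w2)"
    using hom_nf_append[OF h, of "[(j, True)]" w2] assms j by auto
  also have "transvection X u j v [(j, True)] = nf (u @ [(j, True)] @ v)"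
    using transvection_gen[OF j] by (simp add: free_gen_def)
  finally have "transvection X u j v (nf (w1 @ [(j, True)] @ w2))
      = nf (w1 @ nf (nf (u @ [(j, True)] @ v) @ w2))"
    using transvection_fixes[OF assms(1,2)] transvection_fixes[OF assms(3,4)] by simp
  also have "\<dots> = nf (w1 @ (u @ [(j, True)] @ v) @ w2)"
    by (simp only: nf_append_nf_left nf_append_nf_right)
  finally show ?thesis by simp
qed

end

text \<open>
  The words \<open>u\<close> and \<open>v\<close> are fixed, because the letter \<open>j\<close> does not occur in them. Hence the
  transvection along \<open>u\<close> and \<open>v\<close> undoes the one along their inverses.
\<close>

lemma transvection_inverse:
  assumes u: "reduced u" "fst ` set u \<subseteq> X - {j}" and v: "reduced v" "fst ` set v \<subseteq> X - {j}"
    and j: "j \<in> X" and k: "k \<in> X"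
  shows "transvection X u j v (if k = j then nf (word_inv u @ [(j, True)] @ word_inv v) else free_gen k)
    = free_gen k"
proof (cases "k = j")
  case True
  have "transvection X u j v (nf (word_inv u @ [(j, True)] @ word_inv v))
      = nf (word_inv u @ u @ [(j, True)] @ v @ word_inv v)"
    using transvection_word[OF u v j, of "word_inv u" "word_inv v"] u v by (simp add: image_image)
  also have "\<dots> = nf ([(j, True)] @ v @ word_inv v @ [])"
    using nf_cancel'[of "[]" u] by simp
  also have "\<dots> = [(j, True)]" by (subst nf_cancel) simp
  finally show ?thesis using True by (simp add: free_gen_def)
next
  case False
  then show ?thesis using transvection_gen[OF u v j k] by simp
qed

lemma transvection_auto:
  assumes u: "reduced u" "fst ` set u \<subseteq> X - {j}" and v: "reduced v" "fst ` set v \<subseteq> X - {j}"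
    and j: "j \<in> X"
  shows "transvection X u j v \<in> auto (free_group X)"
proof -
  have u': "reduced (word_inv u)" "fst ` set (word_inv u) \<subseteq> X - {j}"
    and v': "reduced (word_inv v)" "fst ` set (word_inv v) \<subseteq> X - {j}"
    using u v by (simp_all add: image_image)
  show ?thesis
    unfolding transvection_def
    by (rule free_lift_auto[OF transvection_funcset[OF u v j] transvection_funcset[OF u' v' j]
          transvection_inverse[OF u v j, unfolded transvection_def]
          transvection_inverse[OF u' v' j, unfolded transvection_def word_inv_word_inv]])
qed

lemma inv_transvection:
  assumes u: "reduced u" "fst ` set u \<subseteq> X - {j}" and v: "reduced v" "fst ` set v \<subseteq> X - {j}"
    and j: "j \<in> X"
  shows "inv\<^bsub>AutoGroup (free_group X)\<^esub> (transvection X u j v)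
    = transvection X (word_inv u) j (word_inv v)"
proof -
  interpret A: group "AutoGroup (free_group X)" by (rule group_AutoGroup_free)
  have u': "reduced (word_inv u)" "fst ` set (word_inv u) \<subseteq> X - {j}"
    and v': "reduced (word_inv v)" "fst ` set (word_inv v) \<subseteq> X - {j}"
    using u v by (simp_all add: image_image)
  note au = transvection_auto[OF u v j] transvection_auto[OF u' v' j]
  show ?thesis
  proof (rule A.inv_equality)
    show "transvection X (word_inv u) j (word_inv v) \<otimes>\<^bsub>AutoGroup (free_group X)\<^esub> transvection X u j v
        = \<one>\<^bsub>AutoGroup (free_group X)\<^esub>"
    proof (rule auto_ext_gen)
      show "transvection X (word_inv u) j (word_inv v) \<otimes>\<^bsub>AutoGroup (free_group X)\<^esub> transvection X u j v
          \<in> auto (free_group X)" "\<one>\<^bsub>AutoGroup (free_group X)\<^esub> \<in> auto (free_group X)"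
        using au A.m_closed A.one_closed by (simp_all add: carrier_AutoGroup)
      fix k assume k: "k \<in> X"
      then show "(transvection X (word_inv u) j (word_inv v)
            \<otimes>\<^bsub>AutoGroup (free_group X)\<^esub> transvection X u j v) (free_gen k)
          = \<one>\<^bsub>AutoGroup (free_group X)\<^esub> (free_gen k)"
        using transvection_inverse[OF u' v' j k, unfolded word_inv_word_inv] transvection_gen[OF u v j k] au
        by (simp add: mult_AutoGroup_apply free_gen_closed one_AutoGroup)
    qed
  qed (use au in \<open>simp_all add: carrier_AutoGroup\<close>)
qed

text \<open>
  Multiplying \<open>\<phi>\<close> on the right by an elementary automorphism changes a single basis image, by a
  Nielsen move on the tuple of basis images of \<open>\<phi>\<close>.
\<close>

lemma mult_transvection_gen:
  assumes \<phi>: "\<phi> \<in> auto (free_group X)"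
    and u: "reduced u" "fst ` set u \<subseteq> X - {j}" and v: "reduced v" "fst ` set v \<subseteq> X - {j}"
    and j: "j \<in> X" and k: "k \<in> X"
  shows "(\<phi> \<otimes>\<^bsub>AutoGroup (free_group X)\<^esub> transvection X u j v) (free_gen k)
    = (if k = j then nf (\<phi> u @ \<phi> (free_gen j) @ \<phi> v) else \<phi> (free_gen k))"
proof -
  note h = auto_hom[OF \<phi>]
  have cl: "fst ` set u \<subseteq> X" "fst ` set v \<subseteq> X" "fst ` set ([(j, True)] @ v) \<subseteq> X"
    "fst ` set [(j, True)] \<subseteq> X" using u v j by auto
  have "\<phi> (nf (u @ [(j, True)] @ v)) = nf (\<phi> u @ nf (\<phi> [(j, True)] @ \<phi> v))"
    using hom_nf_append[OF h cl(1,3)] hom_nf_append[OF h cl(4,2)] u v by simp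
  then show ?thesis
    using mult_AutoGroup_apply[OF \<phi> transvection_auto[OF u v j] free_gen_closed[OF k]]
      transvection_gen[OF u v j k] by (simp add: free_gen_def)
qed

section \<open>The stabilisers and the given generators\<close>

lemma (in group) subgroup_Fix:
  assumes "Y \<subseteq> carrier G" shows "subgroup (Fix G Y) (AutoGroup G)"
proof -
  interpret A: group "AutoGroup G" by (rule AutoGroup)
  show ?thesis
  proof (rule A.subgroupI)
    show "Fix G Y \<subseteq> carrier (AutoGroup G)" by (auto simp: Fix_def carrier_AutoGroup)
    have "\<one>\<^bsub>AutoGroup G\<^esub> \<in> Fix G Y"
      using assms A.one_closed by (auto simp: Fix_def one_AutoGroup carrier_AutoGroup)
    then show "Fix G Y \<noteq> {}" by blast
  next
    fix \<phi> assume \<phi>: "\<phi> \<in> Fix G Y"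
    then have au: "\<phi> \<in> auto G" "inv\<^bsub>AutoGroup G\<^esub> \<phi> \<in> auto G"
      using A.inv_closed[of \<phi>] by (auto simp: Fix_def carrier_AutoGroup)
    have "(inv\<^bsub>AutoGroup G\<^esub> \<phi>) y = y" if "y \<in> Y" for y
    proof -
      have "(inv\<^bsub>AutoGroup G\<^esub> \<phi> \<otimes>\<^bsub>AutoGroup G\<^esub> \<phi>) y = y"
        using A.l_inv[of \<phi>] au that assms by (auto simp: carrier_AutoGroup one_AutoGroup)
      moreover have "\<phi> y = y" using \<phi> that by (simp add: Fix_def)
      ultimately show ?thesis using mult_AutoGroup_apply[OF au(2,1), of y] that assms by auto
    qed
    then show "inv\<^bsub>AutoGroup G\<^esub> \<phi> \<in> Fix G Y" using au by (simp add: Fix_def)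
  next
    fix \<phi> \<psi> assume "\<phi> \<in> Fix G Y" "\<psi> \<in> Fix G Y"
    then show "\<phi> \<otimes>\<^bsub>AutoGroup G\<^esub> \<psi> \<in> Fix G Y"
      using A.m_closed[of \<phi> \<psi>] assms
      by (auto simp: Fix_def carrier_AutoGroup mult_AutoGroup_apply subset_iff)
  qed
qed

lemma (in group) hom_conj:
  assumes "\<phi> \<in> hom G G" "g \<in> carrier G" "y \<in> carrier G"
  shows "\<phi> (g \<otimes> y \<otimes> inv g) = \<phi> g \<otimes> \<phi> y \<otimes> inv (\<phi> g)"
proof -
  interpret h: group_hom G G \<phi>
    using assms(1) is_group by (simp add: group_hom_def group_hom_axioms_def)
  show ?thesis using assms by simp
qed

lemma (in group) subgroup_Fix_conj:
  assumes "Y \<subseteq> carrier G" shows "subgroup (Fix_conj G Y) (AutoGroup G)"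
proof -
  interpret A: group "AutoGroup G" by (rule AutoGroup)
  show ?thesis
  proof (rule A.subgroupI)
    show "Fix_conj G Y \<subseteq> carrier (AutoGroup G)" by (auto simp: Fix_conj_def carrier_AutoGroup)
    have "\<exists>g\<in>carrier G. y = g \<otimes> y \<otimes> inv g" if "y \<in> Y" for y
      using that assms by (intro bexI[of _ \<one>]) auto
    then have "\<one>\<^bsub>AutoGroup G\<^esub> \<in> Fix_conj G Y"
      using assms A.one_closed by (auto simp: Fix_conj_def one_AutoGroup carrier_AutoGroup)
    then show "Fix_conj G Y \<noteq> {}" by blast
  next
    fix \<phi> assume \<phi>: "\<phi> \<in> Fix_conj G Y"
    let ?\<psi> = "inv\<^bsub>AutoGroup G\<^esub> \<phi>"
    have au: "\<phi> \<in> auto G" "?\<psi> \<in> auto G"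
      using A.inv_closed[of \<phi>] \<phi> by (auto simp: Fix_conj_def carrier_AutoGroup)
    have "\<exists>h\<in>carrier G. ?\<psi> y = h \<otimes> y \<otimes> inv h" if y: "y \<in> Y" for y
    proof -
      have yG: "y \<in> carrier G" using y assms by blast
      obtain g where g: "g \<in> carrier G" "\<phi> y = g \<otimes> y \<otimes> inv g"
        using \<phi> y by (auto simp: Fix_conj_def)
      have c: "?\<psi> g \<in> carrier G" "?\<psi> y \<in> carrier G" using auto_closed[OF au(2)] g yG by auto
      have "(?\<psi> \<otimes>\<^bsub>AutoGroup G\<^esub> \<phi>) y = y"
        using A.l_inv[of \<phi>] au yG by (auto simp: carrier_AutoGroup one_AutoGroup)
      then have "?\<psi> (\<phi> y) = y" using mult_AutoGroup_apply[OF au(2,1) yG] by simp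
      then have "y = ?\<psi> g \<otimes> ?\<psi> y \<otimes> inv (?\<psi> g)"
        unfolding g(2) using hom_conj[OF auto_hom[OF au(2)] g(1) yG] by simp
      then have "inv (?\<psi> g) \<otimes> y \<otimes> inv (inv (?\<psi> g)) = ?\<psi> y"
        using c yG by (metis inv_closed inv_inv inv_solve_left inv_solve_right m_assoc m_closed)
      then show ?thesis using c by (metis inv_closed)
    qed
    then show "?\<psi> \<in> Fix_conj G Y" using au by (simp add: Fix_conj_def)
  next
    fix \<phi> \<psi> assume \<phi>: "\<phi> \<in> Fix_conj G Y" and \<psi>: "\<psi> \<in> Fix_conj G Y"
    then have au: "\<phi> \<in> auto G" "\<psi> \<in> auto G" by (auto simp: Fix_conj_def)
    have "\<exists>h\<in>carrier G. (\<phi> \<otimes>\<^bsub>AutoGroup G\<^esub> \<psi>) y = h \<otimes> y \<otimes> inv h" if y: "y \<in> Y" for y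
    proof -
      have yG: "y \<in> carrier G" using y assms by blast
      obtain g h where g: "g \<in> carrier G" "\<psi> y = g \<otimes> y \<otimes> inv g"
        and h: "h \<in> carrier G" "\<phi> y = h \<otimes> y \<otimes> inv h"
        using \<phi> \<psi> y unfolding Fix_conj_def by blast
      have c: "\<phi> g \<in> carrier G" by (rule auto_closed[OF au(1) g(1)])
      have "(\<phi> \<otimes>\<^bsub>AutoGroup G\<^esub> \<psi>) y = \<phi> g \<otimes> (h \<otimes> y \<otimes> inv h) \<otimes> inv (\<phi> g)"
        using mult_AutoGroup_apply[OF au yG] hom_conj[OF auto_hom[OF au(1)] g(1) yG] g(2) h(2) by simp
      also have "\<dots> = (\<phi> g \<otimes> h) \<otimes> y \<otimes> inv (\<phi> g \<otimes> h)"
        using c h(1) yG by (simp add: inv_mult_group m_assoc)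
      finally show ?thesis using c h(1) by blast
    qed
    then show "\<phi> \<otimes>\<^bsub>AutoGroup G\<^esub> \<psi> \<in> Fix_conj G Y"
      using A.m_closed[of \<phi> \<psi>] au by (simp add: Fix_conj_def carrier_AutoGroup)
  qed
qed

(* The basis is indexed by {1..n}, which the simplifier would turn into {Suc 0..n}. *)
declare One_nat_def [simp del]

lemma inv_gen: "j \<in> {1..n} \<Longrightarrow> inv\<^bsub>Fn n\<^esub> (gen j) = [(j, False)]"
  by (rule inv_free_gen)

lemma rho_eq_transvection: "rho n i j = transvection {1..n} [] i [(j, True)]"
  by (simp add: rho_def transvection_def mult_free_group free_gen_def cong: if_cong)

lemma K_aut_eq_transvection:
  "j \<in> {1..n} \<Longrightarrow> K_aut n i j = transvection {1..n} [(j, True)] i [(j, False)]"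
  using nf_append_nf_left[of "[(j, True), (i, True)]" "[(j, False)]"]
  by (simp add: K_aut_def transvection_def mult_free_group free_gen_def inv_free_gen[unfolded free_gen_def]
      cong: if_cong)

lemma S_aut_eq: "S_aut n i = endo n (\<lambda>k. if k = i then [(i, False)] else gen k)" if "i \<in> {1..n}"
  using that by (simp add: S_aut_def inv_gen cong: if_cong)

lemma S_aut_funcset:
  "i \<in> {1..n} \<Longrightarrow> (\<lambda>k. if k = i then [(i, False)] else gen k) \<in> {1..n} \<rightarrow> carrier (Fn n)"
  by (auto simp: carrier_free_group free_gen_closed free_gen_def)

lemma S_aut_hom: "i \<in> {1..n} \<Longrightarrow> S_aut n i \<in> hom (Fn n) (Fn n)"
  unfolding S_aut_eq by (rule group.free_lift_hom[OF group_free_group S_aut_funcset])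

lemma S_aut_gen:
  "i \<in> {1..n} \<Longrightarrow> k \<in> {1..n} \<Longrightarrow> S_aut n i (gen k) = (if k = i then [(i, False)] else gen k)"
  unfolding S_aut_eq by (rule group.free_lift_gen[OF group_free_group S_aut_funcset])

lemma letter_cases: "l = (fst l, True) \<or> l = inv_letter (fst l, True)"
  by (cases l) (auto simp: inv_letter_def)

lemma hom_inv_letter:
  "\<phi> \<in> hom (free_group X) (free_group Z) \<Longrightarrow> fst l \<in> X \<Longrightarrow>
    \<phi> [inv_letter l] = word_inv (\<phi> [l])"
  using hom_word_inv[of \<phi> X Z "[l]"] by (simp add: letter_in_free_group)

lemma S_aut_letter:
  assumes i: "i \<in> {1..n}" and l: "fst l \<in> {1..n}"
  shows "S_aut n i [l] = [if fst l = i then inv_letter l else l]"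
proof -
  have pos: "S_aut n i [(fst l, True)] = [if fst l = i then inv_letter (fst l, True) else (fst l, True)]"
    using S_aut_gen[OF i l] by (auto simp: free_gen_def inv_letter_def)
  then have "S_aut n i [inv_letter (fst l, True)]
      = [if fst l = i then (fst l, True) else inv_letter (fst l, True)]"
    using hom_inv_letter[OF S_aut_hom[OF i], of "(fst l, True)"] l by auto
  with pos show ?thesis by (cases l; cases "snd l") (auto simp: inv_letter_def)
qed

lemma S_aut_auto:
  assumes i: "i \<in> {1..n}" shows "S_aut n i \<in> auto (Fn n)"
  unfolding S_aut_eq[OF i]
proof (rule free_lift_auto)
  fix k assume k: "k \<in> {1..n}"
  then show "endo n (\<lambda>k. if k = i then [(i, False)] else gen k)
      (if k = i then [(i, False)] else gen k) = gen k"
    using S_aut_letter[OF i, of "(i, False)"] S_aut_gen[OF i k] i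
    by (auto simp: S_aut_eq[OF i] inv_letter_def free_gen_def)
  then show "endo n (\<lambda>k. if k = i then [(i, False)] else gen k)
      (if k = i then [(i, False)] else gen k) = gen k" .
qed (rule S_aut_funcset[OF i])+

lemma gens_A_auto: "m \<le> n \<Longrightarrow> gens_A n m \<subseteq> auto (Fn n)"
  by (auto simp: gens_A_def rho_eq_transvection intro!: S_aut_auto transvection_auto)

lemma gens_B_auto: "m \<le> n \<Longrightarrow> gens_B n m \<subseteq> auto (Fn n)"
  using gens_A_auto[of m n]
  by (auto simp: gens_B_def K_aut_eq_transvection intro!: transvection_auto)

subsection \<open>Elementary moves generated by the given automorphisms\<close>

context
  fixes n m :: nat
  assumes mn: "m \<le> n"
begin

lemma right_transvection_generated:
  assumes j: "j \<in> {1..m}" and a: "fst a \<in> {1..n}" "fst a \<noteq> j"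
  shows "transvection {1..n} [] j [a] \<in> generate (AutoGroup (Fn n)) (gens_A n m)"
proof -
  have rho: "transvection {1..n} [] j [(fst a, True)] \<in> gens_A n m"
    unfolding rho_eq_transvection[symmetric] using j a by (auto simp: gens_A_def)
  have "inv\<^bsub>AutoGroup (Fn n)\<^esub> (transvection {1..n} [] j [(fst a, True)])
      = transvection {1..n} [] j [inv_letter (fst a, True)]"
    using inv_transvection[of "[]" "{1..n}" j "[(fst a, True)]"] j a mn by auto
  then show ?thesis
    using letter_cases[of a] generate.incl[OF rho] generate.inv[OF rho] by metis
qed

lemma conj_transvection_generated:
  assumes j: "j \<in> {m+1..n}" and a: "fst a \<in> {1..n}" "fst a \<noteq> j"
  shows "transvection {1..n} [a] j [inv_letter a] \<in> generate (AutoGroup (Fn n)) (gens_B n m)"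
proof -
  let ?b = "(fst a, True)"
  have K: "transvection {1..n} [?b] j [inv_letter ?b] \<in> gens_B n m"
    using K_aut_eq_transvection[of "fst a" n j] j a by (force simp: gens_B_def inv_letter_def)
  have "inv\<^bsub>AutoGroup (Fn n)\<^esub> (transvection {1..n} [?b] j [inv_letter ?b])
      = transvection {1..n} [inv_letter ?b] j [inv_letter (inv_letter ?b)]"
    using inv_transvection[of "[?b]" "{1..n}" j "[inv_letter ?b]"] j a by auto
  then show ?thesis
    using letter_cases[of a] generate.incl[OF K] generate.inv[OF K] by metis
qed

lemma S_aut_generated:
  "j \<in> {1..m} \<Longrightarrow> S_aut n j \<in> generate (AutoGroup (Fn n)) (gens_A n m)"
  by (rule generate.incl) (auto simp: gens_A_def)

text \<open>Inverting \<open>j\<close> turns right multiplication of \<open>j\<close> into left multiplication.\<close>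

lemma left_transvection_generated:
  assumes j: "j \<in> {1..m}" and a: "fst a \<in> {1..n}" "fst a \<noteq> j"
  shows "transvection {1..n} [a] j [] \<in> generate (AutoGroup (Fn n)) (gens_A n m)"
proof -
  interpret A: group "AutoGroup (Fn n)" by (rule group_AutoGroup_free)
  let ?T = "transvection {1..n} [] j [inv_letter a]" and ?S = "S_aut n j"
  have jn: "j \<in> {1..n}" using j mn by auto
  have words: "reduced []" "fst ` set [] \<subseteq> {1..n} - {j}"
    "reduced [inv_letter a]" "fst ` set [inv_letter a] \<subseteq> {1..n} - {j}"
    "reduced [a]" "fst ` set [a] \<subseteq> {1..n} - {j}" using a by auto
  have T: "?T \<in> auto (Fn n)" by (rule transvection_auto[OF words(1-4) jn])
  have S: "?S \<in> auto (Fn n)" by (rule S_aut_auto[OF jn])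
  have TS: "?T \<otimes>\<^bsub>AutoGroup (Fn n)\<^esub> ?S \<in> auto (Fn n)"
    using T S A.m_closed by (simp add: carrier_AutoGroup)
  have L: "transvection {1..n} [a] j [] \<in> auto (Fn n)"
    by (rule transvection_auto[OF words(5,6,1,2) jn])
  have "transvection {1..n} [a] j [] = ?S \<otimes>\<^bsub>AutoGroup (Fn n)\<^esub> (?T \<otimes>\<^bsub>AutoGroup (Fn n)\<^esub> ?S)"
  proof (rule auto_ext_gen[OF L])
    show "?S \<otimes>\<^bsub>AutoGroup (Fn n)\<^esub> (?T \<otimes>\<^bsub>AutoGroup (Fn n)\<^esub> ?S) \<in> auto (Fn n)"
      using TS S A.m_closed by (simp add: carrier_AutoGroup)
    fix k assume k: "k \<in> {1..n}"
    have app: "(?S \<otimes>\<^bsub>AutoGroup (Fn n)\<^esub> (?T \<otimes>\<^bsub>AutoGroup (Fn n)\<^esub> ?S)) (gen k) = ?S (?T (?S (gen k)))"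
      using mult_AutoGroup_apply[OF S TS free_gen_closed[OF k]]
        mult_AutoGroup_apply[OF T S free_gen_closed[OF k]] by simp
    have red: "nf [(j, True), inv_letter a] = [(j, True), inv_letter a]"
      "nf [a, (j, True)] = [a, (j, True)]"
      using a by (auto intro!: nf_reduced simp: inv_letter_def)
    show "transvection {1..n} [a] j [] (gen k)
        = (?S \<otimes>\<^bsub>AutoGroup (Fn n)\<^esub> (?T \<otimes>\<^bsub>AutoGroup (Fn n)\<^esub> ?S)) (gen k)"
    proof (cases "k = j")
      case True
      have "?T [(j, True)] = [(j, True), inv_letter a]"
        using transvection_gen[OF words(1-4) jn jn] red by (simp add: free_gen_def)
      then have "?T [inv_letter (j, True)] = [a, inv_letter (j, True)]"
        using hom_inv_letter[OF auto_hom[OF T], of "(j, True)"] jn by simp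
      moreover have "?S [a, inv_letter (j, True)] = [a, (j, True)]"
      proof -
        have "nf [a, inv_letter (j, True)] = [a, inv_letter (j, True)]"
          using a by (auto intro!: nf_reduced simp: inv_letter_def)
        then show ?thesis
          using hom_nf[OF S_aut_hom[OF jn], of "[a, inv_letter (j, True)]"] a jn red
          by (simp add: S_aut_letter)
      qed
      ultimately show ?thesis
        unfolding app using True transvection_gen[OF words(5,6,1,2) jn jn] S_aut_gen[OF jn jn] red
        by (simp add: free_gen_def inv_letter_def)
    next
      case False
      then show ?thesis
        unfolding app
        using transvection_gen[OF words(5,6,1,2) jn k] transvection_gen[OF words(1-4) jn k]
          S_aut_gen[OF jn k] by simp
    qed
  qed
  then show ?thesis
    using S_aut_generated[OF j] right_transvection_generated[OF j, of "inv_letter a"] a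
    by (simp add: generate.eng)
qed

end

subsection \<open>The given generators are Whitehead automorphisms\<close>

lemma signed_gens_eq: "signed_gens n = (\<lambda>l. [l]) ` {l. fst l \<in> {1..n}}"
proof -
  have "signed_gens n = (\<lambda>i. [(i, True)]) ` {1..n} \<union> (\<lambda>i. [(i, False)]) ` {1..n}"
    unfolding signed_gens_def by (intro arg_cong2[of _ _ _ _ "(\<union>)"] image_cong) (simp_all add: inv_gen, simp add: free_gen_def)
  also have "\<dots> = (\<lambda>l. [l]) ` {l. fst l \<in> {1..n}}" (is "?l = ?r")
  proof
    show "?r \<subseteq> ?l"
    proof
      fix w assume "w \<in> ?r"
      then obtain i s where "w = [(i, s)]" "i \<in> {1..n}" by auto
      then show "w \<in> ?l" by (cases s) auto
    qed
  qed auto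
  finally show ?thesis .
qed

lemma free_lift_cong:
  assumes "f \<in> X \<rightarrow> carrier (free_group X)" "\<And>x. x \<in> X \<Longrightarrow> f x = g x"
  shows "free_lift X (free_group X) f = free_lift X (free_group X) g"
proof -
  have g: "g \<in> X \<rightarrow> carrier (free_group X)" using assms by (auto simp: Pi_iff)
  show ?thesis
    by (rule hom_ext_gen)
      (use assms g in \<open>auto simp: free_lift_extensional group.free_lift_gen[OF group_free_group]
        intro: group.free_lift_hom[OF group_free_group]\<close>)
qed

lemma S_aut_whitehead:
  assumes i: "i \<in> {1..n}" shows "S_aut n i \<in> whitehead n"
proof -
  interpret F: group "Fn n" by (rule group_free_group)
  have "S_aut n i (gen k) = gen (id k) [^]\<^bsub>Fn n\<^esub> (if k = i then -1 else 1 :: int)" if "k \<in> {1..n}" for k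
    using S_aut_gen[OF i that] that free_gen_closed[OF that]
    by (auto simp: F.int_pow_neg inv_gen)
  then have "S_aut n i \<in> whitehead_type1 n"
    unfolding whitehead_type1_def using S_aut_auto[OF i]
    by (intro CollectI conjI exI[of _ id] exI[of _ "\<lambda>k. if k = i then -1 else 1"])
      (auto simp: permutes_id)
  then show ?thesis by (simp add: whitehead_def)
qed

text \<open>
  In \<open>(A, a)\<close> the letter \<open>x\<^sub>i\<close> is multiplied on the right by the inverse of \<open>a\<close> if the inverse of
  \<open>x\<^sub>i\<close> lies in \<open>A\<close>. Therefore \<open>a\<close> is the inverse of \<open>x\<^sub>j\<close> here.
\<close>

lemma rho_whitehead:
  assumes i: "i \<in> {1..n}" and j: "j \<in> {1..n}" and ij: "i \<noteq> j"
  shows "rho n i j \<in> whitehead n"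
proof -
  interpret F: group "Fn n" by (rule group_free_group)
  let ?a = "[(j, False)]" and ?A = "{[(j, False)], [(i, False)]}"
  have a: "?a \<in> carrier (Fn n)" using j by (simp add: carrier_free_group)
  have inva: "inv\<^bsub>Fn n\<^esub> ?a = gen j"
    using inv_free_group[OF a] by (simp add: inv_letter_def free_gen_def)
  have "rho n i j = whitehead_auto n ?A ?a"
    unfolding rho_def whitehead_auto_def
  proof (rule free_lift_cong)
    show "(\<lambda>k. if k = i then gen i \<otimes>\<^bsub>Fn n\<^esub> gen j else gen k) \<in> {1..n} \<rightarrow> carrier (Fn n)"
      using i j by (auto simp: free_gen_closed)
    fix k assume k: "k \<in> {1..n}"
    note kc = free_gen_closed[OF k]
    show "(if k = i then gen i \<otimes>\<^bsub>Fn n\<^esub> gen j else gen k)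
      = (if gen k = ?a \<or> gen k = inv\<^bsub>Fn n\<^esub> ?a then gen k
         else ?a [^]\<^bsub>Fn n\<^esub> (indicator ?A (gen k) :: int) \<otimes>\<^bsub>Fn n\<^esub> gen k
          \<otimes>\<^bsub>Fn n\<^esub> ?a [^]\<^bsub>Fn n\<^esub> (- indicator ?A (inv\<^bsub>Fn n\<^esub> (gen k)) :: int))"
      using a inva ij kc free_gen_closed[OF j]
      by (auto simp: inv_gen[unfolded free_gen_def, OF k] inv_gen[unfolded free_gen_def, OF i]
          indicator_def free_gen_def F.int_pow_neg)
  qed
  moreover have "whitehead_auto n ?A ?a \<in> whitehead_type2 n"
    unfolding whitehead_type2_def
    by (intro CollectI exI[of _ ?A] exI[of _ ?a])
      (use i j in \<open>auto simp: inva signed_gens_eq free_gen_def\<close>)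
  ultimately show ?thesis by (simp add: whitehead_def)
qed

lemma K_aut_whitehead:
  assumes i: "i \<in> {1..n}" and j: "j \<in> {1..n}" and ij: "i \<noteq> j"
  shows "K_aut n i j \<in> whitehead n"
proof -
  interpret F: group "Fn n" by (rule group_free_group)
  let ?a = "[(j, True)]" and ?A = "{[(j, True)], [(i, True)], [(i, False)]}"
  have a: "?a \<in> carrier (Fn n)" using j by (simp add: carrier_free_group)
  have inva: "inv\<^bsub>Fn n\<^esub> ?a = [(j, False)]"
    using inv_free_group[OF a] by (simp add: inv_letter_def)
  have "K_aut n i j = whitehead_auto n ?A ?a"
    unfolding K_aut_def whitehead_auto_def
  proof (rule free_lift_cong)
    show "(\<lambda>k. if k = i then gen j \<otimes>\<^bsub>Fn n\<^esub> gen i \<otimes>\<^bsub>Fn n\<^esub> inv\<^bsub>Fn n\<^esub> (gen j) else gen k)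
        \<in> {1..n} \<rightarrow> carrier (Fn n)"
      using i j by (auto simp: free_gen_closed)
    fix k assume k: "k \<in> {1..n}"
    note kc = free_gen_closed[OF k]
    show "(if k = i then gen j \<otimes>\<^bsub>Fn n\<^esub> gen i \<otimes>\<^bsub>Fn n\<^esub> inv\<^bsub>Fn n\<^esub> (gen j) else gen k)
      = (if gen k = ?a \<or> gen k = inv\<^bsub>Fn n\<^esub> ?a then gen k
         else ?a [^]\<^bsub>Fn n\<^esub> (indicator ?A (gen k) :: int) \<otimes>\<^bsub>Fn n\<^esub> gen k
          \<otimes>\<^bsub>Fn n\<^esub> ?a [^]\<^bsub>Fn n\<^esub> (- indicator ?A (inv\<^bsub>Fn n\<^esub> (gen k)) :: int))"
      using a inva ij kc free_gen_closed[OF j] free_gen_closed[OF i]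
      by (auto simp: inv_gen[unfolded free_gen_def, OF k] inv_gen[unfolded free_gen_def, OF i]
          indicator_def free_gen_def F.int_pow_neg)
  qed
  moreover have "whitehead_auto n ?A ?a \<in> whitehead_type2 n"
    unfolding whitehead_type2_def
    by (intro CollectI exI[of _ ?A] exI[of _ ?a])
      (use i j ij in \<open>auto simp: inva signed_gens_eq\<close>)
  ultimately show ?thesis by (simp add: whitehead_def)
qed

lemma gens_A_subset:
  assumes "m \<le> n"
  shows "gens_A n m \<subseteq> whitehead n \<inter> Fix (Fn n) (gen ` {m+1..n})"
proof
  fix \<phi> assume \<phi>: "\<phi> \<in> gens_A n m"
  then have au: "\<phi> \<in> auto (Fn n)" using gens_A_auto[OF assms] by blast
  from \<phi> consider i where "\<phi> = S_aut n i" "i \<in> {1..m}"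
    | i j where "\<phi> = rho n i j" "i \<in> {1..m}" "j \<in> {1..n}" "i \<noteq> j"
    by (auto simp: gens_A_def)
  then show "\<phi> \<in> whitehead n \<inter> Fix (Fn n) (gen ` {m+1..n})"
  proof cases
    case 1
    then show ?thesis
      using au assms S_aut_whitehead[of i n] by (auto simp: Fix_def S_aut_gen)
  next
    case 2
    have "rho n i j (gen k) = gen k" if "k \<in> {m+1..n}" for k
      using transvection_gen[of "[]" "{1..n}" i "[(j, True)]" k] that 2 assms
      by (auto simp: rho_eq_transvection)
    then show ?thesis
      using 2 au assms rho_whitehead[of i n j] by (auto simp: Fix_def)
  qed
qed

lemma Fix_subset_Fix_conj:
  "Fix (Fn n) (gen ` {m+1..n}) \<subseteq> Fix_conj (Fn n) (gen ` {m+1..n})"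
proof -
  interpret F: group "Fn n" by (rule group_free_group)
  have "\<exists>g\<in>carrier (Fn n). gen k = g \<otimes>\<^bsub>Fn n\<^esub> gen k \<otimes>\<^bsub>Fn n\<^esub> inv\<^bsub>Fn n\<^esub> g" if "k \<in> {m+1..n}" for k
    using free_gen_closed[of k "{1..n}"] that by (intro bexI[of _ "\<one>\<^bsub>Fn n\<^esub>"]) auto
  then show ?thesis by (auto simp: Fix_def Fix_conj_def)
qed

lemma gens_B_subset:
  assumes "m \<le> n"
  shows "gens_B n m \<subseteq> whitehead n \<inter> Fix_conj (Fn n) (gen ` {m+1..n})"
proof
  interpret F: group "Fn n" by (rule group_free_group)
  fix \<phi> assume \<phi>: "\<phi> \<in> gens_B n m"
  then have au: "\<phi> \<in> auto (Fn n)" using gens_B_auto[OF assms] by blast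
  from \<phi> consider "\<phi> \<in> gens_A n m"
    | i j where "\<phi> = K_aut n i j" "i \<in> {m+1..n}" "j \<in> {1..n}" "i \<noteq> j"
    by (auto simp: gens_B_def)
  then show "\<phi> \<in> whitehead n \<inter> Fix_conj (Fn n) (gen ` {m+1..n})"
  proof cases
    case 1
    then show ?thesis using gens_A_subset[OF assms] Fix_subset_Fix_conj by blast
  next
    case 2
    have f: "(\<lambda>k. if k = i then gen j \<otimes>\<^bsub>Fn n\<^esub> gen i \<otimes>\<^bsub>Fn n\<^esub> inv\<^bsub>Fn n\<^esub> (gen j) else gen k)
        \<in> {1..n} \<rightarrow> carrier (Fn n)"
      using 2 by (auto simp: free_gen_closed)
    have "\<exists>g\<in>carrier (Fn n). K_aut n i j (gen k) = g \<otimes>\<^bsub>Fn n\<^esub> gen k \<otimes>\<^bsub>Fn n\<^esub> inv\<^bsub>Fn n\<^esub> g"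
      if k: "k \<in> {m+1..n}" for k
    proof -
      have kn: "k \<in> {1..n}" using k by auto
      have "K_aut n i j (gen k)
          = (if k = i then gen j \<otimes>\<^bsub>Fn n\<^esub> gen i \<otimes>\<^bsub>Fn n\<^esub> inv\<^bsub>Fn n\<^esub> (gen j) else gen k)"
        unfolding K_aut_def by (rule group.free_lift_gen[OF group_free_group f kn])
      then show ?thesis
        using free_gen_closed[OF kn] free_gen_closed[OF 2(3)]
        by (cases "k = i") (auto intro: bexI[of _ "\<one>\<^bsub>Fn n\<^esub>"])
    qed
    then show ?thesis
      using 2 au K_aut_whitehead[of i n j] by (auto simp: Fix_conj_def)
  qed
qed

section \<open>A well-founded order on words\<close>

definition letter_code :: "nat \<times> bool \<Rightarrow> nat" where
  "letter_code l = 2 * fst l + (if snd l then 1 else 0)"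

text \<open>
  Words are read as numerals with the least significant digit first. All that matters is that
  the value distinguishes words of equal length if \<open>B\<close> exceeds the codes of their letters, and that
  replacing an initial segment by one of equal length and smaller value decreases the value.
\<close>

fun word_value :: "nat \<Rightarrow> (nat \<times> bool) list \<Rightarrow> nat" where
  "word_value B [] = 0"
| "word_value B (l # w) = letter_code l + B * word_value B w"

lemma letter_code_inj: "letter_code k = letter_code l \<Longrightarrow> k = l"
  by (cases k; cases l) (auto simp: letter_code_def split: if_splits; presburger)

lemma word_value_append:
  "word_value B (u @ v) = word_value B u + B ^ length u * word_value B v"
  by (induction u) (auto simp: algebra_simps)

lemma word_value_inj:
  assumes "length u = length v" "word_value B u = word_value B v"
    and "\<And>l. l \<in> set u \<union> set v \<Longrightarrow> letter_code l < B"
  shows "u = v"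
  using assms
proof (induction u v rule: list_induct2)
  case (Cons k u l v)
  have less: "letter_code k < B" "letter_code l < B" using Cons.prems(2) by auto
  have eq: "letter_code k + B * word_value B u = letter_code l + B * word_value B v"
    using Cons.prems(1) by simp
  have "letter_code k = letter_code l"
    using arg_cong[OF eq, of "\<lambda>x. x mod B"] less by simp
  moreover from this eq less have "word_value B u = word_value B v" by simp
  ultimately show ?case using Cons.IH Cons.prems(2) letter_code_inj by auto
qed simp

definition half :: "'a list \<Rightarrow> 'a list" where
  "half u = take ((length u + 1) div 2) u"

definition half_value :: "nat \<Rightarrow> (nat \<times> bool) list \<Rightarrow> nat" where
  "half_value B u = word_value B (half u) + word_value B (half (word_inv u))"

text \<open>
  Length alone does not suffice: an entry of even length may cancel completely, one half against
  each neighbour, although no move shortens any entry. Ties are broken by the initial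
  halves of a word and of its inverse, as in Nielsen's method.
\<close>

definition simpler :: "nat \<Rightarrow> (nat \<times> bool) list \<Rightarrow> (nat \<times> bool) list \<Rightarrow> bool" where
  "simpler B u v \<longleftrightarrow>
    length u < length v \<or> length u = length v \<and> half_value B u < half_value B v"

lemma half_value_word_inv [simp]: "half_value B (word_inv u) = half_value B u"
  by (simp add: half_value_def)

lemma simpler_word_inv: "simpler B (word_inv u) (word_inv v) \<longleftrightarrow> simpler B u v"
  by (simp add: simpler_def)

lemma simpler_nf: "simpler B v u \<Longrightarrow> simpler B (nf v) u"
  using length_nf_le[of v] nf_eq_if_length_eq[of v] unfolding simpler_def
  by (metis le_neq_implies_less less_trans order_le_less_trans)

text \<open>
  The prefix \<open>p\<close> lies in the initial half of the word, and \<open>p\<^sup>-\<^sup>1\<close> lies outside the initial half of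
  the inverse word, so the exchange changes only one summand of the value.
\<close>

lemma simpler_prefix:
  assumes len: "length p = length q" and half: "2 * length p \<le> length (p @ w)"
    and val: "word_value B q < word_value B p"
  shows "simpler B (q @ w) (p @ w)"
proof -
  let ?c = "(length (p @ w) + 1) div 2"
  have "length p \<le> ?c" "?c \<le> length w" using half by auto
  then have "half (q @ w) = q @ take (?c - length p) w" "half (p @ w) = p @ take (?c - length p) w"
    "half (word_inv (q @ w)) = take ?c (word_inv w)" "half (word_inv (p @ w)) = take ?c (word_inv w)"
    using len by (auto simp: half_def add.commute)
  then show ?thesis using len val by (simp add: simpler_def half_value_def word_value_append)
qed

text \<open>
  The order on conjugating words \<open>h\<close> that corresponds to \<open>simpler\<close> on the conjugates
  \<open>h x h\<^sup>-\<^sup>1\<close>.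
\<close>

definition prefix_simpler :: "nat \<Rightarrow> (nat \<times> bool) list \<Rightarrow> (nat \<times> bool) list \<Rightarrow> bool" where
  "prefix_simpler B u v \<longleftrightarrow>
    length u < length v \<or> length u = length v \<and> word_value B u < word_value B v"

text \<open>
  The initial halves of \<open>h x h\<^sup>-\<^sup>1\<close> and of its inverse are \<open>h x\<close> and \<open>h x\<^sup>-\<^sup>1\<close>.
\<close>

lemma simpler_conj:
  assumes "prefix_simpler B g h"
  shows "simpler B (g @ [x] @ word_inv g) (h @ [x] @ word_inv h)"
proof -
  have "half (k @ [x] @ word_inv k) = k @ [x]"
    "half (word_inv (k @ [x] @ word_inv k)) = k @ [inv_letter x]" for k
    by (auto simp: half_def)
  then show ?thesis
    using assms by (auto simp: simpler_def prefix_simpler_def half_value_def word_value_append)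
qed

section \<open>Families that admit no simplifying move\<close>

text \<open>
  The family \<open>U\<close> stands for the images of the basis letters under an automorphism that conjugates
  the basis elements beyond \<open>m\<close>. No move simplifies it: neither multiplication of a member
  of index at most \<open>m\<close> by another member, nor conjugation of a member beyond \<open>m\<close> by
  another one, as measured on the conjugating word.
\<close>

locale irreducible_family =
  fixes n m B :: nat and U :: "nat \<times> bool \<Rightarrow> (nat \<times> bool) list"
  assumes U_inv: "\<And>l. fst l \<in> {1..n} \<Longrightarrow> U (inv_letter l) = word_inv (U l)"
    and U_red: "\<And>l. fst l \<in> {1..n} \<Longrightarrow> reduced (U l)"
    and U_ne: "\<And>l. fst l \<in> {1..n} \<Longrightarrow> U l \<noteq> []"
    and U_code: "\<And>l k. fst l \<in> {1..n} \<Longrightarrow> k \<in> set (U l) \<Longrightarrow> letter_code k < B"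
    and U_conj: "\<And>j. j \<in> {m+1..n} \<Longrightarrow> \<exists>h. U (j, True) = h @ [(j, True)] @ word_inv h"
    and no_mult: "\<And>a b. \<lbrakk>fst a \<in> {1..n}; fst b \<in> {1..m}; fst b \<in> {1..n}; fst a \<noteq> fst b\<rbrakk> \<Longrightarrow>
      \<not> simpler B (nf (U a @ U b)) (U b)"
    and no_conj: "\<And>a j g h. \<lbrakk>fst a \<in> {1..n}; j \<in> {m+1..n}; fst a \<noteq> j;
      U (j, True) = h @ [(j, True)] @ word_inv h; nf (U a @ h) = nf g\<rbrakk> \<Longrightarrow> \<not> prefix_simpler B g h"
begin

text \<open>
  Both \<open>U (j, True)\<close> and its inverse are conjugates of a single letter by the same word \<open>h\<close>, and
  that letter stands exactly in the middle.
\<close>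

lemma conj_letter:
  assumes "fst b \<in> {m+1..n}"
  obtains h where "U (fst b, True) = h @ [(fst b, True)] @ word_inv h" "U b = h @ [b] @ word_inv h"
proof -
  obtain h where h: "U (fst b, True) = h @ [(fst b, True)] @ word_inv h"
    using U_conj[OF assms] by blast
  then have "U (inv_letter (fst b, True)) = h @ [inv_letter (fst b, True)] @ word_inv h"
    using U_inv[of "(fst b, True)"] assms by simp
  with h have "U b = h @ [b] @ word_inv h" using letter_cases[of b] by metis
  then show ?thesis using h that by blast
qed

text \<open>
  If more than half of \<open>U a\<close> cancelled inside the conjugating word of \<open>U b\<close>, then conjugating
  \<open>U b\<close> by \<open>U a\<close> would shorten that word.
\<close>

lemma not_mostly_absorbed:
  assumes a: "fst a \<in> {1..n}" and b: "fst b \<in> {m+1..n}" and ab: "fst a \<noteq> fst b"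
    and Ub: "U (fst b, True) = (p @ h) @ [(fst b, True)] @ word_inv (p @ h)"
    and Ua: "U a = p @ a'"
  shows "length p \<le> length a'"
proof (rule ccontr)
  assume "\<not> length p \<le> length a'"
  moreover have "nf (U (inv_letter a) @ p @ h) = nf (word_inv a' @ h)"
    using nf_cancel'[of "word_inv a'" p h] U_inv[OF a] Ua by simp
  ultimately show False
    using no_conj[of "inv_letter a" "fst b" "p @ h" "word_inv a' @ h"] a b ab Ub
    by (auto simp: prefix_simpler_def)
qed

text \<open>
  Otherwise conjugation by \<open>g a\<^sup>-\<^sup>1 g\<^sup>-\<^sup>1\<close> would delete the letter \<open>a\<close> from the conjugating word \<open>h\<close>.
\<close>

lemma not_fully_absorbed:
  assumes a: "fst a \<in> {m+1..n}" and b: "fst b \<in> {m+1..n}" and ab: "fst a \<noteq> fst b"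
    and Ub: "U (fst b, True) = h @ [(fst b, True)] @ word_inv h"
    and Ua: "U a = g @ [a] @ word_inv g"
  shows "h \<noteq> g @ [a] @ h'"
proof
  assume h: "h = g @ [a] @ h'"
  have "nf (U (inv_letter a) @ h) = nf ((g @ [inv_letter a]) @ word_inv g @ g @ [a] @ h')"
    using U_inv[of a] a Ua h by simp
  also have "\<dots> = nf ((g @ [inv_letter a]) @ [a] @ h')" by (rule nf_cancel')
  also have "\<dots> = nf (g @ h')" using nf_cancel[of g "[inv_letter a]" h'] by simp
  finally show False
    using no_conj[of "inv_letter a" "fst b" h "g @ h'"] a b ab Ub h by (auto simp: prefix_simpler_def)
qed

lemma prefix_of_conj:
  assumes "p @ b' = h @ x # t"
  shows "(\<exists>h'. h = p @ h') \<or> (\<exists>r. p = h @ x # r)"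
  using assms by (auto simp: append_eq_append_conv2 append_eq_Cons_conv Cons_eq_append_conv)

text \<open>
  Suppose that \<open>p\<close> is longer than half of \<open>U a\<close>; then \<open>a\<close> and \<open>b\<close> are not inverse to each other.
  Multiplying by the inverse of \<open>U a\<close> shortens \<open>U b\<close>, so \<open>U b\<close> is a conjugate \<open>h b h\<^sup>-\<^sup>1\<close>. The
  prefix \<open>p\<close> is not contained in \<open>h\<close>, as conjugation would shorten \<open>h\<close>. So it reaches the middle
  of \<open>U b\<close>, that is, \<open>p\<close> is longer than half of \<open>U b\<close> as well, and by symmetry
  \<open>U a\<close> is a conjugate \<open>g a g\<^sup>-\<^sup>1\<close> whose middle is reached. If \<open>g\<close> and \<open>h\<close> have the same length,
  then the middle letters \<open>a\<close> and \<open>b\<close> agree; otherwise the longer of \<open>g\<close> and \<open>h\<close>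
  passes through the middle letter of the other member and can be shortened.
\<close>

lemma common_prefix_at_most_half:
  assumes a: "fst a \<in> {1..n}" and b: "fst b \<in> {1..n}" and ne: "a \<noteq> b"
    and Ua: "U a = p @ a'" and Ub: "U b = p @ b'"
  shows "2 * length p \<le> length (U a)"
proof (rule ccontr)
  assume "\<not> 2 * length p \<le> length (U a)"
  then have long: "length a' < length p" using Ua by simp
  have ab: "fst a \<noteq> fst b"
  proof
    assume "fst a = fst b"
    then have "b = inv_letter a" using ne by (auto simp: inv_letter_def prod_eq_iff)
    then have "word_inv (U a) = p @ b'" using Ub U_inv[OF a] by simp
    from no_half_self_inverse[OF U_red[OF a] Ua this] show False
      using U_ne[OF a] long Ua by simp
  qed
  have absorbs: False if "length c' < length p" "fst c \<in> {1..n}" "fst d \<in> {1..m}" "fst d \<in> {1..n}"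
    "fst c \<noteq> fst d" "U c = p @ c'" "U d = p @ d'" for c d c' d'
  proof -
    have "nf (U (inv_letter c) @ U d) = nf (word_inv c' @ d')"
      using nf_cancel'[of "word_inv c'" p d'] U_inv[OF that(2)] that(6,7) by simp
    moreover have "length (nf (word_inv c' @ d')) < length (U d)"
      using length_nf_le[of "word_inv c' @ d'"] that(1,7) by simp
    ultimately show False
      using no_mult[of "inv_letter c" d] that by (simp add: simpler_def)
  qed
  have bm: "fst b \<in> {m+1..n}" using absorbs[of a' a b b'] long a b ab Ua Ub by force
  obtain h where h: "U (fst b, True) = h @ [(fst b, True)] @ word_inv h" "U b = h @ [b] @ word_inv h"
    using conj_letter[OF bm] .
  have "\<nexists>h'. h = p @ h'"
    using not_mostly_absorbed[OF a bm ab _ Ua] h(1) long by (metis linorder_not_le)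
  then obtain r where r: "p = h @ b # r"
    using prefix_of_conj[of p b' h b "word_inv h"] h(2) Ub by auto
  have "length p + length b' = 2 * length h + 1"
    using arg_cong[OF h(2), of length] Ub by simp
  then have long': "length b' < length p" using r by simp
  have am: "fst a \<in> {m+1..n}" using absorbs[of b' b a a'] long' a b ab Ua Ub by force
  obtain g where g: "U (fst a, True) = g @ [(fst a, True)] @ word_inv g" "U a = g @ [a] @ word_inv g"
    using conj_letter[OF am] .
  have "\<nexists>g'. g = p @ g'"
    using not_mostly_absorbed[OF b am _ _ Ub] ab g(1) long' by (metis linorder_not_le)
  then obtain s where s: "p = g @ a # s"
    using prefix_of_conj[of p a' g a "word_inv g"] g(2) Ua by auto
  have eq: "g @ a # s = h @ b # r" using r s by simp
  consider "length g = length h" | "length g < length h" | "length h < length g" by linarith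
  then show False
  proof cases
    case 1
    then show False using eq ne by simp
  next
    case 2
    then obtain h' where "h = g @ [a] @ h'"
      using eq by (auto simp: append_eq_append_conv2 Cons_eq_append_conv append_eq_Cons_conv)
    then show False using not_fully_absorbed[OF am bm ab h(1) g(2)] by blast
  next
    case 3
    then obtain g' where "g = h @ [b] @ g'"
      using eq by (auto simp: append_eq_append_conv2 Cons_eq_append_conv append_eq_Cons_conv)
    then show False using not_fully_absorbed[OF bm am _ g(1) h(2)] ab by auto
  qed
qed

text \<open>
  Multiplication by a member \<open>q p\<^sup>-\<^sup>1\<close> whose halves have equal length exchanges the prefix \<open>p\<close> of
  another member for \<open>q\<close>.
\<close>

lemma no_smaller_half:
  assumes a: "fst a \<in> {1..n}" and d: "fst d \<in> {1..n}" and ad: "fst a \<noteq> fst d"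
    and Ud: "U d = q @ word_inv p" and Ua: "U a = p @ a'"
    and len: "length p = length q" and half: "2 * length p \<le> length (U a)"
  shows "\<not> word_value B q < word_value B p"
proof
  assume val: "word_value B q < word_value B p"
  show False
  proof (cases "fst a \<le> m")
    case True
    have "nf (U d @ U a) = nf (q @ a')" using nf_cancel'[of q p a'] Ud Ua by simp
    moreover have "simpler B (nf (q @ a')) (U a)"
      unfolding Ua using simpler_prefix[OF len _ val, of a'] half Ua by (simp add: simpler_nf)
    ultimately show False using no_mult[of d a] a d ad True by auto
  next
    case False
    then have am: "fst a \<in> {m+1..n}" using a by simp
    obtain h where h: "U (fst a, True) = h @ [(fst a, True)] @ word_inv h" "U a = h @ [a] @ word_inv h"
      using conj_letter[OF am] .
    have "\<nexists>r. p = h @ a # r" using half h(2) by auto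
    then obtain h' where h': "h = p @ h'"
      using prefix_of_conj[of p a' h a "word_inv h"] h(2) Ua by auto
    have "nf (U d @ h) = nf (q @ h')" using nf_cancel'[of q p h'] Ud h' by simp
    moreover have "prefix_simpler B (q @ h') h"
      using val len h' by (simp add: prefix_simpler_def word_value_append)
    ultimately show False using no_conj[of d "fst a" h "q @ h'"] h(1) am d ad by auto
  qed
qed

text \<open>
  By the previous bound both cancelling parts of \<open>U b\<close> are halves, so \<open>U b\<close> is \<open>p q\<^sup>-\<^sup>1\<close> with \<open>p\<close>
  and \<open>q\<close> of equal length. They differ, hence have different values, and whichever is larger could be
  exchanged for the smaller one in \<open>U a\<close> or \<open>U c\<close>.
\<close>

lemma no_complete_cancellation:
  assumes a: "fst a \<in> {1..n}" and b: "fst b \<in> {1..n}" and c: "fst c \<in> {1..n}"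
    and ab: "a \<noteq> b" and cb: "c \<noteq> inv_letter b"
    and Ua: "U a = p @ a'" and Ub: "U b = p @ word_inv q" and Uc: "U c = q @ c'"
  shows False
proof -
  have Uib: "U (inv_letter b) = q @ word_inv p" using U_inv[OF b] Ub by simp
  have "2 * length p \<le> length (U b)"
    using common_prefix_at_most_half[OF b a _ Ub Ua] ab by simp
  moreover have "2 * length q \<le> length (U (inv_letter b))"
    using common_prefix_at_most_half[OF _ c _ Uib Uc] b cb by simp
  ultimately have len: "length p = length q" using Ub Uib by simp
  have pq: "p \<noteq> q"
  proof
    assume "p = q"
    then show False
      using no_half_self_inverse[OF U_red[OF b] Ub, of "word_inv p"] Ub U_ne[OF b] by simp
  qed
  have afst: "fst a \<noteq> fst b"
  proof
    assume "fst a = fst b"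
    then have "a = inv_letter b" using ab by (auto simp: inv_letter_def prod_eq_iff)
    then show False using Ua Uib len pq by (simp add: append_eq_append_conv)
  qed
  have cfst: "fst c \<noteq> fst b"
  proof
    assume "fst c = fst b"
    then have "c = b" using cb by (auto simp: inv_letter_def prod_eq_iff)
    then show False using Uc Ub len pq by (simp add: append_eq_append_conv)
  qed
  have "2 * length p \<le> length (U a)" by (rule common_prefix_at_most_half[OF a b ab Ua Ub])
  then have 1: "\<not> word_value B q < word_value B p"
    using no_smaller_half[of a "inv_letter b", OF a _ _ Uib Ua len] b afst by simp
  have "2 * length q \<le> length (U c)"
    using common_prefix_at_most_half[OF c _ cb Uc Uib] b by simp
  then have "\<not> word_value B p < word_value B q"
    using no_smaller_half[of c b, OF c b cfst Ub Uc len[symmetric]] by simp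
  with 1 have "word_value B p = word_value B q" by simp
  moreover have "letter_code l < B" if "l \<in> set p \<union> set q" for l
    using that U_code[OF b, of l] U_code[OF c, of l] Ub Uc by auto
  ultimately show False using word_value_inj[OF len] pq by blast
qed

lemma length_le_product:
  assumes "reduced w" "fst ` set w \<subseteq> {1..n}"
  shows "length w \<le> length (nf (concat (map U w)))"
proof (cases w)
  case (Cons l v)
  have "\<exists>r s t. nf (concat (map U (l # v))) = r @ s \<and> U l = r @ t \<and> r \<noteq> [] \<and> length v \<le> length s \<and>
      (t = [] \<or> v \<noteq> [] \<and> (\<exists>c'. U (hd v) = word_inv t @ c'))"
  proof (rule nielsen_product_length[where L = "{l. fst l \<in> {1..n}}"])
    show "2 * length p \<le> length (U a)"
      if "a \<in> {l. fst l \<in> {1..n}}" "b \<in> {l. fst l \<in> {1..n}}" "a \<noteq> b" "U a = p @ a'" "U b = p @ b'"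
      for a b p a' b'
      using common_prefix_at_most_half[of a b p a' b'] that by simp
    show False
      if "a \<in> {l. fst l \<in> {1..n}}" "b \<in> {l. fst l \<in> {1..n}}" "c \<in> {l. fst l \<in> {1..n}}"
        "a \<noteq> b" "c \<noteq> inv_letter b" "U a = p @ a'" "U b = p @ word_inv q" "U c = q @ c'"
      for a b c p q a' c'
      using no_complete_cancellation[of a b c p a' q c'] that by simp
  qed (use assms Cons U_inv U_red U_ne in auto)
  then obtain r s where "nf (concat (map U w)) = r @ s" "r \<noteq> []" "length v \<le> length s"
    using Cons by blast
  then show ?thesis using Cons by (cases r) auto
qed simp

end

section \<open>Simplifying an automorphism\<close>

text \<open>
  A conjugating word whose last letter is \<open>x\<close> or its inverse can be shortened; if it ends
  otherwise, then nothing cancels.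
\<close>

lemma reduced_conjugate:
  "reduced g \<Longrightarrow> \<exists>h. nf (g @ [x] @ word_inv g) = h @ [x] @ word_inv h"
proof (induction g rule: rev_induct)
  case Nil
  then show ?case by (intro exI[of _ "[]"]) simp
next
  case (snoc l g)
  have g: "reduced g" using snoc.prems by (simp add: reduced_append_iff)
  show ?case
  proof (cases "fst l = fst x")
    case True
    then have "l = x \<or> l = inv_letter x" by (auto simp: inv_letter_def prod_eq_iff)
    then have "nf ((g @ [l]) @ [x] @ word_inv (g @ [l])) = nf (g @ [x] @ word_inv g)"
      using nf_cancel[of "g @ [x]" "[x]" "word_inv g"] nf_cancel'[of g "[x]" "[x] @ word_inv g"]
      by auto
    then show ?thesis using snoc.IH[OF g] by simp
  next
    case False
    have "reduced (word_inv (g @ [l]))" using snoc.prems by (simp only: reduced_word_inv)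
    then have "reduced ([x] @ word_inv (g @ [l]))"
      using False by (auto simp: reduced_append_iff inv_letter_def)
    then have "reduced ((g @ [l]) @ [x] @ word_inv (g @ [l]))"
      using snoc.prems False by (subst reduced_append_iff) (auto simp: inv_letter_def)
    then show ?thesis using nf_reduced by blast
  qed
qed

lemma Fix_conj_gen:
  assumes "\<phi> \<in> Fix_conj (Fn n) (gen ` {m+1..n})" and j: "j \<in> {m+1..n}"
  shows "\<exists>h. \<phi> (gen j) = h @ [(j, True)] @ word_inv h"
proof -
  obtain g where g: "g \<in> carrier (Fn n)"
    "\<phi> (gen j) = g \<otimes>\<^bsub>Fn n\<^esub> gen j \<otimes>\<^bsub>Fn n\<^esub> inv\<^bsub>Fn n\<^esub> g"
    using assms unfolding Fix_conj_def by blast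
  have red: "reduced g" using g(1) by (simp add: carrier_free_group)
  have "\<phi> (gen j) = nf (nf (g @ [(j, True)]) @ word_inv g)"
    using g red by (simp add: inv_free_group mult_free_group free_gen_def)
  then show ?thesis using reduced_conjugate[OF red, of "(j, True)"] by (simp only: nf_append_nf_left) simp
qed

text \<open>
  A strict bound for the codes of the letters with index at most \<open>n\<close>, which serves as the base of
  \<open>word_value\<close>.
\<close>

definition code_bound :: "nat \<Rightarrow> nat" where
  "code_bound n = 2 * n + 2"

definition complexity :: "nat \<Rightarrow> (fgelem \<Rightarrow> fgelem) \<Rightarrow> nat \<times> nat" where
  "complexity n \<phi> = (\<Sum>k\<in>{1..n}. length (\<phi> (gen k)),
    \<Sum>k\<in>{1..n}. half_value (code_bound n) (\<phi> (gen k)))"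

lemma complexity_decreases:
  assumes j: "j \<in> {1..n}" and simpler: "simpler (code_bound n) (\<psi> (gen j)) (\<phi> (gen j))"
    and same: "\<And>k. k \<in> {1..n} \<Longrightarrow> k \<noteq> j \<Longrightarrow> \<psi> (gen k) = \<phi> (gen k)"
  shows "(complexity n \<psi>, complexity n \<phi>) \<in> less_than <*lex*> less_than"
proof -
  have split: "(\<Sum>k\<in>{1..n}. f (\<theta> (gen k))) = f (\<theta> (gen j)) + (\<Sum>k\<in>{1..n} - {j}. f (\<theta> (gen k)))"
    for f :: "fgelem \<Rightarrow> nat" and \<theta>
    using sum.remove[OF finite_atLeastAtMost j] .
  have rest: "(\<Sum>k\<in>{1..n} - {j}. f (\<psi> (gen k))) = (\<Sum>k\<in>{1..n} - {j}. f (\<phi> (gen k)))"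
    for f :: "fgelem \<Rightarrow> nat"
    using same by (intro sum.cong) auto
  show ?thesis
    using simpler unfolding complexity_def split[of _ \<psi>] split[of _ \<phi>] rest
    by (auto simp: simpler_def)
qed

context
  fixes n m :: nat
  assumes mn: "m \<le> n"
begin

interpretation A: group "AutoGroup (Fn n)"
  by (rule group_AutoGroup_free)

abbreviation (input) "genA \<equiv> generate (AutoGroup (Fn n)) (gens_A n m)"
abbreviation (input) "genB \<equiv> generate (AutoGroup (Fn n)) (gens_B n m)"

lemma generated_subgroups:
  "subgroup (generate (AutoGroup (Fn n)) (gens_A n m)) (AutoGroup (Fn n))"
  "subgroup (generate (AutoGroup (Fn n)) (gens_B n m)) (AutoGroup (Fn n))"
  by (rule A.generate_is_subgroup, simp add: carrier_AutoGroup gens_A_auto[OF mn])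
    (rule A.generate_is_subgroup, simp add: carrier_AutoGroup gens_B_auto[OF mn])

lemma stabiliser_subgroups:
  "subgroup (Fix (Fn n) (gen ` {m+1..n})) (AutoGroup (Fn n))"
  "subgroup (Fix_conj (Fn n) (gen ` {m+1..n})) (AutoGroup (Fn n))"
proof -
  have "gen ` {m+1..n} \<subseteq> carrier (Fn n)" by (auto simp: free_gen_closed)
  then show "subgroup (Fix (Fn n) (gen ` {m+1..n})) (AutoGroup (Fn n))"
    "subgroup (Fix_conj (Fn n) (gen ` {m+1..n})) (AutoGroup (Fn n))"
    using group.subgroup_Fix[OF group_free_group] group.subgroup_Fix_conj[OF group_free_group] by auto
qed

lemma genA_subset_genB: "genA \<subseteq> genB"
  by (rule A.mono_generate) (auto simp: gens_B_def)

lemma genA_subset_Fix: "genA \<subseteq> Fix (Fn n) (gen ` {m+1..n})"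
  using gens_A_subset[OF mn] by (intro A.generate_subgroup_incl stabiliser_subgroups) auto

lemma genB_subset_Fix_conj: "genB \<subseteq> Fix_conj (Fn n) (gen ` {m+1..n})"
  using gens_B_subset[OF mn] by (intro A.generate_subgroup_incl stabiliser_subgroups) auto

text \<open>
  If \<open>b\<close> is an inverse letter, then left multiplication of \<open>\<phi> [b]\<close> is right multiplication of the
  corresponding basis image, and the order on words does not distinguish a word from its inverse.
\<close>

lemma multiplication_simplifies:
  assumes \<phi>: "\<phi> \<in> auto (Fn n)"
    and a: "fst a \<in> {1..n}" and b: "fst b \<in> {1..m}" and ab: "fst a \<noteq> fst b"
    and simpler: "simpler (code_bound n) (nf (\<phi> [a] @ \<phi> [b])) (\<phi> [b])"
  shows "\<exists>\<psi>\<in>genA. (complexity n (\<phi> \<otimes>\<^bsub>AutoGroup (Fn n)\<^esub> \<psi>), complexity n \<phi>)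
    \<in> less_than <*lex*> less_than"
proof -
  let ?j = "fst b"
  have j: "?j \<in> {1..n}" using b mn by auto
  note h = auto_hom[OF \<phi>]
  have nil: "\<phi> [] = []" using hom_nf[OF h, of "[]"] by simp
  have words: "reduced []" "fst ` set [] \<subseteq> {1..n} - {?j}"
    "reduced [inv_letter a]" "fst ` set [inv_letter a] \<subseteq> {1..n} - {?j}"
    "reduced [a]" "fst ` set [a] \<subseteq> {1..n} - {?j}" using a ab by auto
  consider "b = (?j, True)" | "b = inv_letter (?j, True)" using letter_cases by blast
  then show ?thesis
  proof cases
    case 1
    let ?T = "transvection {1..n} [a] ?j []"
    note g = mult_transvection_gen[OF \<phi> words(5,6,1,2) j]
    have "(\<phi> \<otimes>\<^bsub>AutoGroup (Fn n)\<^esub> ?T) (gen ?j) = nf (\<phi> [a] @ \<phi> [b])" "\<phi> (gen ?j) = \<phi> [b]"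
      using g[OF j] nil 1 by (simp_all add: free_gen_def)
    then show ?thesis
      using left_transvection_generated[OF mn b a ab] complexity_decreases[OF j, of "\<phi> \<otimes>\<^bsub>AutoGroup (Fn n)\<^esub> ?T" \<phi>]
        simpler g by auto
  next
    case 2
    let ?T = "transvection {1..n} [] ?j [inv_letter a]"
    note g = mult_transvection_gen[OF \<phi> words(1-4) j]
    have b': "\<phi> [b] = word_inv (\<phi> (gen ?j))"
      using hom_inv_letter[OF h, of "(?j, True)"] 2 j by (simp add: free_gen_def)
    have "(\<phi> \<otimes>\<^bsub>AutoGroup (Fn n)\<^esub> ?T) (gen ?j) = nf (\<phi> (gen ?j) @ word_inv (\<phi> [a]))"
      using g[OF j] nil hom_inv_letter[OF h a] by simp
    also have "\<dots> = word_inv (nf (\<phi> [a] @ \<phi> [b]))"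
      using nf_word_inv[of "\<phi> [a] @ \<phi> [b]"] b' by simp
    finally have "simpler (code_bound n) ((\<phi> \<otimes>\<^bsub>AutoGroup (Fn n)\<^esub> ?T) (gen ?j)) (\<phi> (gen ?j))"
      using simpler b' simpler_word_inv[of _ "nf (\<phi> [a] @ \<phi> [b])" "\<phi> [b]"] by simp
    then show ?thesis
      using right_transvection_generated[OF mn b, of "inv_letter a"] a ab g
        complexity_decreases[OF j, of "\<phi> \<otimes>\<^bsub>AutoGroup (Fn n)\<^esub> ?T" \<phi>] by auto
  qed
qed

text \<open>
  A conjugation simplifies only where the conjugating word is nonempty, that is, where \<open>\<phi>\<close> moves a
  basis element beyond \<open>m\<close>. This is why the same descent serves for both stabilisers.
\<close>

lemma conjugation_simplifies:
  assumes \<phi>: "\<phi> \<in> auto (Fn n)"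
    and a: "fst a \<in> {1..n}" and j: "j \<in> {m+1..n}" and aj: "fst a \<noteq> j"
    and h: "\<phi> (gen j) = h @ [(j, True)] @ word_inv h"
    and g: "nf (\<phi> [a] @ h) = nf g" and simpler: "prefix_simpler (code_bound n) g h"
  shows "\<phi> \<notin> Fix (Fn n) (gen ` {m+1..n}) \<and>
    (\<exists>\<psi>\<in>genB. (complexity n (\<phi> \<otimes>\<^bsub>AutoGroup (Fn n)\<^esub> \<psi>), complexity n \<phi>)
      \<in> less_than <*lex*> less_than)"
proof
  have "h \<noteq> []" using simpler by (auto simp: prefix_simpler_def)
  then have "\<phi> (gen j) \<noteq> gen j" using h by (auto simp: free_gen_def dest: arg_cong[of _ _ length])
  then show "\<phi> \<notin> Fix (Fn n) (gen ` {m+1..n})" using j by (auto simp: Fix_def)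
  have jn: "j \<in> {1..n}" using j by auto
  have words: "reduced [inv_letter a]" "fst ` set [inv_letter a] \<subseteq> {1..n} - {j}"
    "reduced [a]" "fst ` set [a] \<subseteq> {1..n} - {j}" using a aj by auto
  let ?T = "transvection {1..n} [a] j [inv_letter a]"
  note gen = mult_transvection_gen[OF \<phi> words(3,4,1,2) jn]
  have "(\<phi> \<otimes>\<^bsub>AutoGroup (Fn n)\<^esub> ?T) (gen j) = nf (\<phi> [a] @ \<phi> (gen j) @ word_inv (\<phi> [a]))"
    using gen[OF jn] hom_inv_letter[OF auto_hom[OF \<phi>] a] by simp
  also have "\<dots> = nf ((\<phi> [a] @ h) @ [(j, True)] @ word_inv (\<phi> [a] @ h))" by (simp add: h)
  also have "\<dots> = nf (g @ [(j, True)] @ word_inv g)"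
    using g nf_word_inv[of "\<phi> [a] @ h"] nf_word_inv[of g]
    by (intro nf_cong_append) simp_all
  finally have "simpler (code_bound n) ((\<phi> \<otimes>\<^bsub>AutoGroup (Fn n)\<^esub> ?T) (gen j)) (\<phi> (gen j))"
    using simpler_nf[OF simpler_conj[OF simpler]] h by simp
  then show "\<exists>\<psi>\<in>genB. (complexity n (\<phi> \<otimes>\<^bsub>AutoGroup (Fn n)\<^esub> \<psi>), complexity n \<phi>)
      \<in> less_than <*lex*> less_than"
    using conj_transvection_generated[OF mn j a aj] gen
      complexity_decreases[OF jn, of "\<phi> \<otimes>\<^bsub>AutoGroup (Fn n)\<^esub> ?T" \<phi>] by auto
qed

text \<open>
  The \<open>n\<close> generators are images of letters with distinct indices, so every index is used.
\<close>

lemma basis_permuted_if_letters_hit: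
  assumes \<phi>: "\<phi> \<in> auto (Fn n)"
    and hit: "\<And>k. k \<in> {1..n} \<Longrightarrow> \<exists>l. fst l \<in> {1..n} \<and> \<phi> [l] = gen k"
    and j: "j \<in> {1..n}"
  shows "length (\<phi> (gen j)) = 1"
proof -
  obtain f where f: "\<And>k. k \<in> {1..n} \<Longrightarrow> fst (f k) \<in> {1..n} \<and> \<phi> [f k] = gen k"
    using hit by metis
  have inv: "\<phi> [inv_letter l] = word_inv (\<phi> [l])" if "fst l \<in> {1..n}" for l
    by (rule hom_inv_letter[OF auto_hom[OF \<phi>] that])
  have "inj_on (\<lambda>k. fst (f k)) {1..n}"
  proof (rule inj_onI)
    fix k k' assume k: "k \<in> {1..n}" "k' \<in> {1..n}" "fst (f k) = fst (f k')"
    then have "f k' = f k \<or> f k' = inv_letter (f k)" by (auto simp: inv_letter_def prod_eq_iff)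
    then show "k = k'"
      using f[OF k(1)] f[OF k(2)] inv[of "f k"] by (auto simp: free_gen_def inv_letter_def)
  qed
  then have "(\<lambda>k. fst (f k)) ` {1..n} = {1..n}"
    using f by (intro endo_inj_surj) auto
  then obtain k where k: "k \<in> {1..n}" "fst (f k) = j" using j by (metis (no_types, lifting) imageE)
  then have "f k = (j, True) \<or> f k = inv_letter (j, True)" using letter_cases[of "f k"] by simp
  then have "gen k = \<phi> (gen j) \<or> gen k = word_inv (\<phi> (gen j))"
    using f[OF k(1)] inv[of "(j, True)"] j by (auto simp: free_gen_def)
  then show ?thesis by (auto simp: free_gen_def dest: arg_cong[of _ _ length])
qed

text \<open>
  If no elementary factor simplifies \<open>\<phi>\<close>, then its basis images form an irreducible family. Each
  generator is \<open>\<phi> w\<close> for some reduced \<open>w\<close> because \<open>\<phi>\<close> is surjective, and \<open>w\<close> is not longer than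
  \<open>\<phi> w\<close>, so it is a letter. Hence \<open>\<phi>\<close> permutes the letters of the basis.
\<close>

lemma simplifying_factor:
  assumes \<phi>: "\<phi> \<in> Fix_conj (Fn n) (gen ` {m+1..n})"
    and long: "\<not> (\<forall>k\<in>{1..n}. length (\<phi> (gen k)) = 1)"
  shows "\<exists>\<psi>. (\<psi> \<in> genA \<or> \<psi> \<in> genB \<and> \<phi> \<notin> Fix (Fn n) (gen ` {m+1..n})) \<and>
    (complexity n (\<phi> \<otimes>\<^bsub>AutoGroup (Fn n)\<^esub> \<psi>), complexity n \<phi>) \<in> less_than <*lex*> less_than"
proof (rule ccontr)
  assume none: "\<not> ?thesis"
  have au: "\<phi> \<in> auto (Fn n)" using \<phi> by (simp add: Fix_conj_def)
  note h = auto_hom[OF au]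
  have nil: "\<phi> [] = []" using hom_nf[OF h, of "[]"] by simp
  have nilc: "[] \<in> carrier (Fn n)" by (simp add: carrier_free_group)
  have cl: "\<phi> [l] \<in> carrier (Fn n)" if "fst l \<in> {1..n}" for l
    by (rule auto_closed[OF au letter_in_free_group[OF that]])
  interpret irreducible_family n m "code_bound n" "\<lambda>l. \<phi> [l]"
  proof
    fix l :: "nat \<times> bool" assume l: "fst l \<in> {1..n}"
    show "\<phi> [inv_letter l] = word_inv (\<phi> [l])" by (rule hom_inv_letter[OF h l])
    show "reduced (\<phi> [l])" using cl[OF l] by (simp add: carrier_free_group)
    show "\<phi> [l] \<noteq> []"
      using inj_onD[OF auto_inj_on[OF au] _ letter_in_free_group[OF l] nilc] nil by auto
    fix k assume "k \<in> set (\<phi> [l])"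
    then have "fst k \<in> {1..n}" using cl[OF l] by (auto simp: carrier_free_group)
    then show "letter_code k < code_bound n" by (simp add: letter_code_def code_bound_def)
  next
    fix j assume "j \<in> {m+1..n}"
    then show "\<exists>h. \<phi> [(j, True)] = h @ [(j, True)] @ word_inv h"
      using Fix_conj_gen[OF \<phi>] by (simp add: free_gen_def)
  next
    fix a b :: "nat \<times> bool"
    assume "fst a \<in> {1..n}" "fst b \<in> {1..m}" "fst a \<noteq> fst b"
    then show "\<not> simpler (code_bound n) (nf (\<phi> [a] @ \<phi> [b])) (\<phi> [b])"
      using multiplication_simplifies[OF au] none by blast
  next
    fix a :: "nat \<times> bool" and j g h
    assume "fst a \<in> {1..n}" "j \<in> {m+1..n}" "fst a \<noteq> j"
      "\<phi> [(j, True)] = h @ [(j, True)] @ word_inv h" "nf (\<phi> [a] @ h) = nf g"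
    then show "\<not> prefix_simpler (code_bound n) g h"
      using conjugation_simplifies[OF au, unfolded free_gen_def, of a j h g] none
      unfolding free_gen_def by blast
  qed
  have "\<exists>l. fst l \<in> {1..n} \<and> \<phi> [l] = gen k" if k: "k \<in> {1..n}" for k
  proof -
    obtain w where w: "w \<in> carrier (Fn n)" "\<phi> w = gen k"
      using auto_surj[OF au] free_gen_closed[OF k] by (metis imageE)
    have w': "reduced w" "fst ` set w \<subseteq> {1..n}" using w(1) by (simp_all add: carrier_free_group)
    have "length w \<le> length (\<phi> w)"
      using length_le_product[OF w'] hom_nf[OF h w'(2)] w'(1) by simp
    then have "length w \<le> 1" using w(2) by (simp add: free_gen_def)
    moreover have "w \<noteq> []" using w(2) nil by (auto simp: free_gen_def)
    ultimately obtain l where "w = [l]" by (cases w) auto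
    then show ?thesis using w w' by (intro exI[of _ l]) auto
  qed
  then show False using basis_permuted_if_letters_hit[OF au] long by blast
qed

section \<open>Signed permutations of the basis\<close>

text \<open>
  Three Nielsen moves take the pair \<open>(x\<^sub>i, x\<^sub>j)\<close> through \<open>(x\<^sub>i x\<^sub>j, x\<^sub>j)\<close> and \<open>(x\<^sub>i x\<^sub>j, x\<^sub>i\<^sup>-\<^sup>1)\<close> to
  \<open>(x\<^sub>j, x\<^sub>i\<^sup>-\<^sup>1)\<close>.
\<close>

lemma signed_swap_generated:
  assumes i: "i \<in> {1..m}" and j: "j \<in> {1..m}" and ij: "i \<noteq> j"
  shows "\<exists>\<psi>\<in>genA. \<psi> (gen i) = gen j \<and> \<psi> (gen j) = [(i, False)] \<and>
    (\<forall>k\<in>{1..n} - {i, j}. \<psi> (gen k) = gen k)"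
proof -
  have n: "i \<in> {1..n}" "j \<in> {1..n}" using i j mn by auto
  let ?T1 = "transvection {1..n} [] i [(j, True)]"
  let ?T2 = "transvection {1..n} [] j [(i, False)]"
  let ?T3 = "transvection {1..n} [(j, True)] i []"
  let ?P = "?T1 \<otimes>\<^bsub>AutoGroup (Fn n)\<^esub> ?T2"
  have gen: "?T1 \<in> genA" "?T2 \<in> genA" "?T3 \<in> genA"
    using right_transvection_generated[OF mn] left_transvection_generated[OF mn] i j n ij by auto
  have wi: "reduced []" "fst ` set [] \<subseteq> {1..n} - {i}"
    "reduced [(j, True)]" "fst ` set [(j, True)] \<subseteq> {1..n} - {i}" using n ij by auto
  have wj: "reduced []" "fst ` set [] \<subseteq> {1..n} - {j}"
    "reduced [(i, False)]" "fst ` set [(i, False)] \<subseteq> {1..n} - {j}" using n ij by auto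
  have au: "?T1 \<in> auto (Fn n)" "?P \<in> auto (Fn n)"
    using subgroup.mem_carrier[OF generated_subgroups(1)] gen generate.eng[OF gen(1,2)]
    by (simp_all only: carrier_AutoGroup)
  note T1 = transvection_gen[OF wi n(1)]
  have nil: "?T1 [] = []" "?P [] = []"
    using hom_nf[OF auto_hom[OF au(1)], of "[]"] hom_nf[OF auto_hom[OF au(2)], of "[]"] by simp_all
  have red: "nf [(i, True), (j, True)] = [(i, True), (j, True)]"
    using ij by (intro nf_reduced) (simp add: inv_letter_def)
  have T1i: "?T1 [(i, True)] = [(i, True), (j, True)]" and T1j: "?T1 [(j, True)] = [(j, True)]"
    using T1[OF n(1)] T1[OF n(2)] ij red by (simp_all add: free_gen_def)
  have T1i': "?T1 [(i, False)] = [(j, False), (i, False)]"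
    using hom_inv_letter[OF auto_hom[OF au(1)], of "(i, True)"] n T1i by (simp add: inv_letter_def)
  note P = mult_transvection_gen[OF au(1) wj n(2)]
  have Pj: "?P [(j, True)] = [(i, False)]"
    using P[OF n(2)] T1j T1i' nil nf_cancel[of "[]" "[(j, True)]" "[(i, False)]"]
    by (simp add: free_gen_def inv_letter_def)
  have Pi: "?P [(i, True)] = [(i, True), (j, True)]"
    using P[OF n(1)] ij T1i by (simp add: free_gen_def)
  note Q = mult_transvection_gen[OF au(2) wi(3,4,1,2) n(1)]
  have Qi: "(?P \<otimes>\<^bsub>AutoGroup (Fn n)\<^esub> ?T3) (gen i) = gen j"
    using Q[OF n(1)] Pj Pi nil nf_cancel'[of "[]" "[(i, True)]" "[(j, True)]"]
    by (simp add: free_gen_def inv_letter_def)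
  have Qj: "(?P \<otimes>\<^bsub>AutoGroup (Fn n)\<^esub> ?T3) (gen j) = [(i, False)]"
    using Q[OF n(2)] Pj ij by (simp add: free_gen_def)
  have Qk: "(?P \<otimes>\<^bsub>AutoGroup (Fn n)\<^esub> ?T3) (gen k) = gen k" if "k \<in> {1..n} - {i, j}" for k
    using Q[of k] P[of k] T1[of k] that by auto
  show ?thesis
    using generate.eng[OF generate.eng[OF gen(1,2)] gen(3)] Qi Qj Qk by blast
qed

text \<open>
  An element that is merely inverted counts less than one that is moved elsewhere, since a signed
  swap may bring an element home inverted.
\<close>

definition displacement :: "(fgelem \<Rightarrow> fgelem) \<Rightarrow> nat \<Rightarrow> nat" where
  "displacement \<phi> k = (if \<phi> (gen k) = gen k then 0 else if \<phi> (gen k) = [(k, False)] then 1 else 2)"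

text \<open>
  A conjugate of \<open>x\<^sub>k\<close> of length one is \<open>x\<^sub>k\<close> itself, so only the first \<open>m\<close> basis elements are
  permuted or inverted. Factors \<open>S_aut\<close> and signed swaps decrease the total displacement.
\<close>

lemma signed_permutation_generated:
  assumes "\<phi> \<in> Fix_conj (Fn n) (gen ` {m+1..n})" "\<forall>k\<in>{1..n}. length (\<phi> (gen k)) = 1"
  shows "\<phi> \<in> genA"
  using assms
proof (induction "\<Sum>k\<in>{1..n}. displacement \<phi> k" arbitrary: \<phi> rule: less_induct)
  case less
  have au: "\<phi> \<in> auto (Fn n)" using less.prems by (simp add: Fix_conj_def)
  note h = auto_hom[OF au]
  have fixed: "\<phi> (gen k) = gen k" if k: "k \<in> {m+1..n}" for k
  proof -
    obtain g where g: "\<phi> (gen k) = g @ [(k, True)] @ word_inv g"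
      using Fix_conj_gen[OF less.prems(1) k] by blast
    then have "g = []" using less.prems(2) k by (auto dest: bspec[of _ _ k])
    then show ?thesis using g by (simp add: free_gen_def)
  qed
  have step: "\<phi> \<in> genA" if \<psi>: "\<psi> \<in> genA"
    and len: "\<forall>k\<in>{1..n}. length (\<phi> (\<psi> (gen k))) = 1"
    and decr: "(\<Sum>k\<in>{1..n}. displacement (\<lambda>x. \<phi> (\<psi> x)) k) < (\<Sum>k\<in>{1..n}. displacement \<phi> k)"
    for \<psi>
  proof -
    have \<psi>au: "\<psi> \<in> auto (Fn n)"
      using subgroup.mem_carrier[OF generated_subgroups(1) \<psi>] by (simp add: carrier_AutoGroup)
    have app: "(\<phi> \<otimes>\<^bsub>AutoGroup (Fn n)\<^esub> \<psi>) (gen k) = \<phi> (\<psi> (gen k))" if "k \<in> {1..n}" for k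
      using mult_AutoGroup_apply[OF au \<psi>au free_gen_closed[OF that]] .
    have "(\<Sum>k\<in>{1..n}. displacement (\<phi> \<otimes>\<^bsub>AutoGroup (Fn n)\<^esub> \<psi>) k)
        = (\<Sum>k\<in>{1..n}. displacement (\<lambda>x. \<phi> (\<psi> x)) k)"
      using app by (intro sum.cong) (auto simp: displacement_def)
    moreover have "\<phi> \<otimes>\<^bsub>AutoGroup (Fn n)\<^esub> \<psi> \<in> Fix_conj (Fn n) (gen ` {m+1..n})"
      using subgroup.m_closed[OF stabiliser_subgroups(2) less.prems(1)]
        \<psi> genA_subset_genB genB_subset_Fix_conj by blast
    ultimately have prod: "\<phi> \<otimes>\<^bsub>AutoGroup (Fn n)\<^esub> \<psi> \<in> genA"
      using less.hyps decr len app by auto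
    have "\<phi> \<in> carrier (AutoGroup (Fn n))" "\<psi> \<in> carrier (AutoGroup (Fn n))"
      using au \<psi>au by (simp_all add: carrier_AutoGroup)
    then have "\<phi> = (\<phi> \<otimes>\<^bsub>AutoGroup (Fn n)\<^esub> \<psi>) \<otimes>\<^bsub>AutoGroup (Fn n)\<^esub> inv\<^bsub>AutoGroup (Fn n)\<^esub> \<psi>"
      by (simp add: A.m_assoc)
    then show ?thesis
      using subgroup.m_closed[OF generated_subgroups(1) prod
          subgroup.m_inv_closed[OF generated_subgroups(1) \<psi>]] by simp
  qed
  consider "\<forall>k\<in>{1..n}. \<phi> (gen k) = gen k"
    | k where "k \<in> {1..n}" "\<phi> (gen k) = [(k, False)]"
    | i where "i \<in> {1..n}" "\<phi> (gen i) \<noteq> gen i" "\<forall>k\<in>{1..n}. \<phi> (gen k) \<noteq> [(k, False)]"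
    by blast
  then show ?case
  proof cases
    case 1
    have "\<phi> = \<one>\<^bsub>AutoGroup (Fn n)\<^esub>"
    proof (rule auto_ext_gen[OF au])
      show "\<one>\<^bsub>AutoGroup (Fn n)\<^esub> \<in> auto (Fn n)" using A.one_closed by (simp add: carrier_AutoGroup)
    qed (use 1 in \<open>simp add: one_AutoGroup free_gen_closed\<close>)
    then show ?thesis by (simp add: generate.one)
  next
    case (2 k)
    then have km: "k \<in> {1..m}" using fixed[of k] by (cases "k \<le> m") (auto simp: free_gen_def)
    have Sk: "\<phi> (S_aut n k (gen k)) = gen k"
      using S_aut_gen[OF 2(1) 2(1)] hom_inv_letter[OF h, of "(k, True)"] 2
      by (simp add: inv_letter_def free_gen_def)
    have Sl: "\<phi> (S_aut n k (gen l)) = \<phi> (gen l)" if "l \<in> {1..n}" "l \<noteq> k" for l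
      using S_aut_gen[OF 2(1) that(1)] that by simp
    have "(\<Sum>l\<in>{1..n}. displacement (\<lambda>x. \<phi> (S_aut n k x)) l) < (\<Sum>l\<in>{1..n}. displacement \<phi> l)"
    proof (rule sum_strict_mono_ex1)
      show "\<forall>l\<in>{1..n}. displacement (\<lambda>x. \<phi> (S_aut n k x)) l \<le> displacement \<phi> l"
      proof
        fix l assume "l \<in> {1..n}"
        then show "displacement (\<lambda>x. \<phi> (S_aut n k x)) l \<le> displacement \<phi> l"
          using Sk Sl[of l] by (cases "l = k") (auto simp: displacement_def)
      qed
      show "\<exists>l\<in>{1..n}. displacement (\<lambda>x. \<phi> (S_aut n k x)) l < displacement \<phi> l"
        using 2 Sk by (intro bexI[of _ k]) (auto simp: displacement_def free_gen_def)
    qed simp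
    moreover have "\<forall>l\<in>{1..n}. length (\<phi> (S_aut n k (gen l))) = 1"
      using Sk Sl less.prems(2) by (metis One_nat_def free_gen_def length_Cons list.size(3))
    ultimately show ?thesis using step[OF S_aut_generated[OF mn km]] by blast
  next
    case (3 i)
    \<comment> \<open>Some \<open>j\<close> is sent to \<open>i\<close> up to sign, and swapping \<open>i\<close> with \<open>j\<close> repairs \<open>i\<close>.\<close>
    define \<sigma> where "\<sigma> k = fst (hd (\<phi> (gen k)))" for k
    have single: "\<exists>s. \<phi> (gen k) = [(\<sigma> k, s)]" if k: "k \<in> {1..n}" for k
    proof -
      obtain l where "\<phi> (gen k) = [l]" 
        using bspec[OF less.prems(2) k] by (auto simp: length_Suc_conv One_nat_def)
      then show ?thesis by (cases l) (simp add: \<sigma>_def)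
    qed
    have letter: "\<phi> (gen k) = [(\<sigma> k, s)] \<Longrightarrow> \<phi> [(k, False)] = [(\<sigma> k, \<not> s)]" if "k \<in> {1..n}" for k s
      using hom_inv_letter[OF h, of "(k, True)"] that by (simp add: inv_letter_def free_gen_def)
    have "inj_on \<sigma> {1..n}"
    proof (rule inj_onI)
      fix k l assume k: "k \<in> {1..n}" and l: "l \<in> {1..n}" and eq: "\<sigma> k = \<sigma> l"
      obtain s t where "\<phi> (gen k) = [(\<sigma> k, s)]" "\<phi> (gen l) = [(\<sigma> k, t)]"
        using single[OF k] single[OF l] eq by auto
      then have "\<phi> (gen k) = \<phi> (gen l) \<or> \<phi> (gen k) = \<phi> [(l, False)]"
        using letter[OF l, of t] eq by (cases "s = t") auto
      then have "gen k = gen l \<or> gen k = [(l, False)]"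
        using inj_onD[OF auto_inj_on[OF au]] free_gen_closed[OF k] free_gen_closed[OF l]
          letter_in_free_group[of "(l, False)" "{1..n}"] l by auto
      then show "k = l" by (auto simp: free_gen_def)
    qed
    moreover have "\<sigma> ` {1..n} \<subseteq> {1..n}"
    proof
      fix x assume "x \<in> \<sigma> ` {1..n}"
      then obtain k where k: "k \<in> {1..n}" "x = \<sigma> k" by blast
      then show "x \<in> {1..n}"
        using single[OF k(1)] auto_closed[OF au free_gen_closed[OF k(1)]] by (auto simp: carrier_free_group)
    qed
    ultimately have surj: "\<sigma> ` {1..n} = {1..n}" by (intro endo_inj_surj) auto
    obtain j where j: "j \<in> {1..n}" "\<sigma> j = i" using surj 3(1) by (metis imageE)
    have \<sigma>i: "\<sigma> i \<noteq> i"
    proof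
      assume "\<sigma> i = i"
      then obtain s where "\<phi> (gen i) = [(i, s)]" using single[OF 3(1)] by auto
      then show False using 3 by (cases s) (auto simp: free_gen_def)
    qed
    then have ij: "i \<noteq> j" using j by blast
    have unfixed: "\<phi> (gen j) \<noteq> gen j" using j ij by (auto simp: \<sigma>_def free_gen_def)
    have m: "i \<in> {1..m}" "j \<in> {1..m}" using fixed[of i] fixed[of j] 3 j unfixed by force+
    obtain \<psi> where \<psi>: "\<psi> \<in> genA" "\<psi> (gen i) = gen j" "\<psi> (gen j) = [(i, False)]"
      "\<And>k. k \<in> {1..n} - {i, j} \<Longrightarrow> \<psi> (gen k) = gen k"
      using signed_swap_generated[OF m ij] by blast
    obtain s t where s: "\<phi> (gen j) = [(i, s)]" and t: "\<phi> (gen i) = [(\<sigma> i, t)]"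
      using single[OF j(1)] single[OF 3(1)] j(2) by auto
    have \<psi>i: "\<phi> (\<psi> (gen i)) = [(i, s)]" and \<psi>j: "\<phi> (\<psi> (gen j)) = [(\<sigma> i, \<not> t)]"
      using \<psi> s letter[OF 3(1) t] by auto
    have "(\<Sum>l\<in>{1..n}. displacement (\<lambda>x. \<phi> (\<psi> x)) l) < (\<Sum>l\<in>{1..n}. displacement \<phi> l)"
    proof (rule sum_strict_mono_ex1)
      have two: "displacement \<phi> i = 2" "displacement \<phi> j = 2"
        using 3 j unfixed by (auto simp: displacement_def)
      show "\<forall>l\<in>{1..n}. displacement (\<lambda>x. \<phi> (\<psi> x)) l \<le> displacement \<phi> l"
      proof
        fix l assume "l \<in> {1..n}"
        then consider "l = i" | "l = j" | "\<psi> (gen l) = gen l" using \<psi>(4)[of l] by blast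
        then show "displacement (\<lambda>x. \<phi> (\<psi> x)) l \<le> displacement \<phi> l"
          by cases (use two in \<open>auto simp: displacement_def\<close>)
      qed
      show "\<exists>l\<in>{1..n}. displacement (\<lambda>x. \<phi> (\<psi> x)) l < displacement \<phi> l"
        using 3(1) two \<psi>i by (intro bexI[of _ i]) (cases s; auto simp: displacement_def free_gen_def)+
    qed simp
    moreover have "\<forall>l\<in>{1..n}. length (\<phi> (\<psi> (gen l))) = 1"
    proof
      fix l assume l: "l \<in> {1..n}"
      then consider "l = i" | "l = j" | "\<psi> (gen l) = gen l" using \<psi>(4)[of l] by blast
      then show "length (\<phi> (\<psi> (gen l))) = 1"
        by cases (use \<psi>i \<psi>j less.prems(2) l in auto)
    qed
    ultimately show ?thesis using step[OF \<psi>(1)] by blast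
  qed
qed

section \<open>Generation of the stabilisers\<close>

text \<open>
  Descent along the complexity. As long as the automorphism fixes the basis elements beyond \<open>m\<close>,
  the simplifying factors come from \<open>gens_A\<close> and therefore preserve this property.
\<close>

lemma stabilisers_generated:
  assumes "\<phi> \<in> Fix_conj (Fn n) (gen ` {m+1..n})"
  shows "\<phi> \<in> genB \<and> (\<phi> \<in> Fix (Fn n) (gen ` {m+1..n}) \<longrightarrow> \<phi> \<in> genA)"
proof -
  have "wf (less_than <*lex*> less_than)" by (simp add: wf_lex_prod)
  then have "wf (inv_image (less_than <*lex*> less_than) (complexity n))" by (rule wf_inv_image)
  then show ?thesis using assms
  proof (induction \<phi> rule: wf_induct_rule)
    case (less \<phi>)
    show ?case
    proof (cases "\<forall>k\<in>{1..n}. length (\<phi> (gen k)) = 1")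
      case True
      then show ?thesis
        using signed_permutation_generated[OF less.prems] genA_subset_genB by blast
    next
      case False
      let ?G = "AutoGroup (Fn n)"
      obtain \<psi> where \<psi>: "\<psi> \<in> genA \<or> \<psi> \<in> genB \<and> \<phi> \<notin> Fix (Fn n) (gen ` {m+1..n})"
        and decr: "(complexity n (\<phi> \<otimes>\<^bsub>?G\<^esub> \<psi>), complexity n \<phi>) \<in> less_than <*lex*> less_than"
        using simplifying_factor[OF less.prems False] by blast
      have \<psi>B: "\<psi> \<in> genB" using \<psi> genA_subset_genB by blast
      have "\<phi> \<in> carrier ?G" "\<psi> \<in> carrier ?G"
        using less.prems subgroup.mem_carrier[OF generated_subgroups(2) \<psi>B]
        by (auto simp: Fix_conj_def carrier_AutoGroup)
      then have \<phi>: "\<phi> = (\<phi> \<otimes>\<^bsub>?G\<^esub> \<psi>) \<otimes>\<^bsub>?G\<^esub> inv\<^bsub>?G\<^esub> \<psi>"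
        by (simp add: A.m_assoc)
      have "\<phi> \<otimes>\<^bsub>?G\<^esub> \<psi> \<in> Fix_conj (Fn n) (gen ` {m+1..n})"
        using subgroup.m_closed[OF stabiliser_subgroups(2) less.prems] \<psi>B genB_subset_Fix_conj by blast
      then have IH: "\<phi> \<otimes>\<^bsub>?G\<^esub> \<psi> \<in> genB"
        "\<phi> \<otimes>\<^bsub>?G\<^esub> \<psi> \<in> Fix (Fn n) (gen ` {m+1..n}) \<Longrightarrow> \<phi> \<otimes>\<^bsub>?G\<^esub> \<psi> \<in> genA"
        using less.IH[of "\<phi> \<otimes>\<^bsub>?G\<^esub> \<psi>"] decr by auto
      show ?thesis
      proof (intro conjI impI)
        show "\<phi> \<in> genB"
          using subgroup.m_closed[OF generated_subgroups(2) IH(1)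
              subgroup.m_inv_closed[OF generated_subgroups(2) \<psi>B]] \<phi> by simp
        assume F: "\<phi> \<in> Fix (Fn n) (gen ` {m+1..n})"
        then have \<psi>A: "\<psi> \<in> genA" using \<psi> by blast
        then have "\<phi> \<otimes>\<^bsub>?G\<^esub> \<psi> \<in> genA"
          using IH(2) subgroup.m_closed[OF stabiliser_subgroups(1) F] genA_subset_Fix by blast
        then show "\<phi> \<in> genA"
          using subgroup.m_closed[OF generated_subgroups(1) _
              subgroup.m_inv_closed[OF generated_subgroups(1) \<psi>A]] \<phi> by metis
      qed
    qed
  qed
qed

end

theorem theorem4p1:
  fixes m n :: nat
    and Y :: "fgelem set"
  assumes "m \<le> n"
    and "Y = gen ` {m+1..n}"
  shows "generate (AutoGroup (Fn n)) (whitehead n \<inter> Fix (Fn n) Y) = Fix (Fn n) Y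
    \<and> generate (AutoGroup (Fn n)) (whitehead n \<inter> Fix_conj (Fn n) Y) = Fix_conj (Fn n) Y
    \<and> generate (AutoGroup (Fn n)) (gens_A n m) = Fix (Fn n) Y
    \<and> generate (AutoGroup (Fn n)) (gens_B n m) = Fix_conj (Fn n) Y"
proof -
  interpret A: group "AutoGroup (Fn n)" by (rule group_AutoGroup_free)
  note sub = stabiliser_subgroups[OF assms(1), folded assms(2)]
  have A: "Fix (Fn n) Y \<subseteq> generate (AutoGroup (Fn n)) (gens_A n m)"
    and B: "Fix_conj (Fn n) Y \<subseteq> generate (AutoGroup (Fn n)) (gens_B n m)"
    using stabilisers_generated[OF assms(1)] Fix_subset_Fix_conj[of n m] assms(2) by auto
  have "generate (AutoGroup (Fn n)) (gens_A n m)
      \<subseteq> generate (AutoGroup (Fn n)) (whitehead n \<inter> Fix (Fn n) Y)"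
    "generate (AutoGroup (Fn n)) (gens_B n m)
      \<subseteq> generate (AutoGroup (Fn n)) (whitehead n \<inter> Fix_conj (Fn n) Y)"
    unfolding assms(2)
    by (rule A.mono_generate[OF gens_A_subset[OF assms(1)]])
      (rule A.mono_generate[OF gens_B_subset[OF assms(1)]])
  moreover have "generate (AutoGroup (Fn n)) (whitehead n \<inter> Fix (Fn n) Y) \<subseteq> Fix (Fn n) Y"
    "generate (AutoGroup (Fn n)) (whitehead n \<inter> Fix_conj (Fn n) Y) \<subseteq> Fix_conj (Fn n) Y"
    using A.generate_subgroup_incl[OF _ sub(1)] A.generate_subgroup_incl[OF _ sub(2)] by auto
  ultimately show ?thesis using A B by blast
qed

end
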